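(* If $G$ is a graph with cut vertex $v$, then $G$ is not $(e)$-positive at $v$.
   Context: All graphs are finite and simple with nonempty vertex set. A cut vertex of $G$ is a vertex whose deletion (with all incident edges) increases the number of connected components. A labelled graph on $d$ vertices is a graph with vertex set $[d]=\{1,\dots,d\}$. For a set partition $\pi$ of $[d]$, let $B_{\pi,i}$ be the block containing $i$, and let $e_\pi=\sum x_{i_1}\cdots x_{i_d}$ in noncommuting variables $x_1,x_2,\dots$, summed over all tuples $(i_1,\dots,i_d)$ of positive integers with $i_j\ne i_k$ whenever $j\neq k$ and $B_{\pi,j}=B_{\pi,k}$. The $e_\pi$, over set partitions $\pi$ of $[d]$, form a $\mathbb Q$-basis of $\mathrm{NCSym}^d$, the degree-$d$ part of the algebra of symmetric functions in noncommuting variables. For $d\ge 1$ let $\mathrm{type}(\pi)=(\lambda,b)$, where $b=|B_{\pi,d}|$ and $\lambda$ is the integer partition (possibly empty) formed by the sizes of the other blocks. $\mathrm{UBCSym}^d$ is the $\mathbb Q$-vector space with basis $\{e_{(\lambda,b)}\}$ over pairs of a partition $\lambda$ and an integer $b\ge 1$ with $|\lambda|+b=d$, and $\nu:\mathrm{NCSym}^d\to\mathrm{UBCSym}^d$ is the linear map with $\nu(e_\pi)=e_{\mathrm{type}(\pi)}$. For a labelled graph $G$ on $d$ vertices, $Y_G=\sum_\kappa x_{\kappa(1)}\cdots x_{\kappa(d)}\in\mathrm{NCSym}^d$, summed over all proper colourings $\kappa:[d]\to\mathbb Z_{>0}$ of $G$, and $y_G=\nu(Y_G)$. For a graph $G$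 on $d$ vertices with distinguished vertex $v$, $y_{G:v}=y_{G'}$ where $G'$ is any labelling of $G$ by $[d]$ in which $v$ has label $d$ (this does not depend on the choice of such labelling). $G$ is $(e)$-positive at $v$ if all coefficients of $y_{G:v}$ in the basis $\{e_{(\lambda,b)}\}$ are nonnegative. *)

theory Defs
  imports
    "HOL-Library.Function_Algebras"
    "HOL-Library.FuncSet"
    "HOL-Library.Disjoint_Sets"
    "HOL-Library.Multiset"
    "HOL-Library.Poly_Mapping"
    "Graph_Theory.Digraph_Component"
begin

text \<open>
  A finite simple graph is a digraph satisfying \<^locale>\<open>graph\<close>: finite, loop-free, without
  parallel arcs, and with arcs in both directions between adjacent vertices. By this symmetry its
  connected components are its strongly connected components.
\<close>

definition cut_vertex :: "('a, 'b) pre_digraph \<Rightarrow> 'a \<Rightarrow> bool" where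
  "cut_vertex G v \<longleftrightarrow> v \<in> verts G \<and>
     card (pre_digraph.sccs (pre_digraph.del_vert G v)) > card (pre_digraph.sccs G)"


text \<open>
  A formal power series over \<open>\<rat>\<close> in the noncommuting variables \<open>x\<^sub>1, x\<^sub>2, \<dots>\<close> is its coefficient
  function on words; the word \<open>[i\<^sub>1, \<dots>, i\<^sub>d]\<close> stands for \<open>x\<^bsub>i\<^sub>1\<^esub> \<cdots> x\<^bsub>i\<^sub>d\<^esub>\<close>.
\<close>

type_synonym nc_series = "nat list \<Rightarrow> rat"

definition nc_scale :: "rat \<Rightarrow> nc_series \<Rightarrow> nc_series" where
  "nc_scale c f = (\<lambda>w. c * f w)"

interpretation nc: vector_space nc_scale
  by unfold_locales (auto simp: nc_scale_def fun_eq_iff algebra_simps)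

text \<open>The sum of \<open>x\<^bsub>\<kappa>(1)\<^esub> \<cdots> x\<^bsub>\<kappa>(d)\<^esub>\<close> over all \<open>\<kappa>\<close> in a set \<open>K\<close> of maps on \<open>{1..d}\<close>.\<close>

definition nc_monomial_sum :: "nat \<Rightarrow> (nat \<Rightarrow> nat) set \<Rightarrow> nc_series" where
  "nc_monomial_sum d K = (\<lambda>w. of_nat (card {\<kappa> \<in> K. map \<kappa> [1..<Suc d] = w}))"

definition block :: "nat set set \<Rightarrow> nat \<Rightarrow> nat set" where
  "block \<pi> i = (THE B. B \<in> \<pi> \<and> i \<in> B)"

definition nc_e :: "nat \<Rightarrow> nat set set \<Rightarrow> nc_series" where
  "nc_e d \<pi> = nc_monomial_sum d {\<kappa> \<in> {1..d} \<rightarrow>\<^sub>E {0<..}.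
     \<forall>j\<in>{1..d}. \<forall>k\<in>{1..d}. j \<noteq> k \<and> block \<pi> j = block \<pi> k \<longrightarrow> \<kappa> j \<noteq> \<kappa> k}"

text \<open>
  The basis vector \<open>e\<^bsub>(\<lambda>,b)\<^esub>\<close> is \<open>Poly_Mapping.single (\<lambda>, b) 1\<close>, where the integer partition \<open>\<lambda>\<close> is
  the multiset of its parts; so \<^const>\<open>Poly_Mapping.lookup\<close> gives the coefficients in this basis.
  \<open>UBCSym\<close> in degree \<open>d\<close> consists of the elements with support in \<open>ubc_types d\<close>.
\<close>

type_synonym ubc_sym = "(nat multiset \<times> nat) \<Rightarrow>\<^sub>0 rat"

definition ubc_types :: "nat \<Rightarrow> (nat multiset \<times> nat) set" where
  "ubc_types d = {(l, b). 0 \<notin># l \<and> b \<ge> 1 \<and> sum_mset l + b = d}"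

definition partition_type :: "nat \<Rightarrow> nat set set \<Rightarrow> nat multiset \<times> nat" where
  "partition_type d \<pi> =
     (image_mset card (mset_set (\<pi> - {block \<pi> d})), card (block \<pi> d))"

text \<open>
  The linear map sending \<open>nc_e d \<pi>\<close> to \<open>e\<^bsub>type(\<pi>)\<^esub>\<close>. The \<open>nc_e d \<pi>\<close> form a basis of the symmetric
  series that are homogeneous of degree \<open>d\<close>, and \<open>nc.representation\<close> gives the coordinates
  with respect to it (its values off the span are an irrelevant convention).
\<close>

definition nu :: "nat \<Rightarrow> nc_series \<Rightarrow> ubc_sym" where
  "nu d f = (\<Sum>\<pi> | partition_on {1..d} \<pi>. Poly_Mapping.single (partition_type d \<pi>)
     (nc.representation (nc_e d ` {\<pi>. partition_on {1..d} \<pi>}) f (nc_e d \<pi>)))"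


definition proper_colourings :: "(nat, 'b) pre_digraph \<Rightarrow> (nat \<Rightarrow> nat) set" where
  "proper_colourings G =
     {\<kappa> \<in> verts G \<rightarrow>\<^sub>E {0<..}. \<forall>u v. u \<rightarrow>\<^bsub>G\<^esub> v \<longrightarrow> \<kappa> u \<noteq> \<kappa> v}"

text \<open>The next two are meant for labelled graphs, i.e. \<open>verts G = {1..d}\<close>.\<close>

definition chromatic_Y :: "(nat, 'b) pre_digraph \<Rightarrow> nc_series" where
  "chromatic_Y G = nc_monomial_sum (card (verts G)) (proper_colourings G)"

definition chromatic_y :: "(nat, 'b) pre_digraph \<Rightarrow> ubc_sym" where
  "chromatic_y G = nu (card (verts G)) (chromatic_Y G)"

definition relabel :: "('a \<Rightarrow> 'c) \<Rightarrow> ('a, 'b) pre_digraph \<Rightarrow> ('c, 'b) pre_digraph" where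
  "relabel \<phi> G = \<lparr>verts = \<phi> ` verts G, arcs = arcs G, tail = \<phi> \<circ> tail G, head = \<phi> \<circ> head G\<rparr>"

definition labelling_at :: "('a, 'b) pre_digraph \<Rightarrow> 'a \<Rightarrow> ('a \<Rightarrow> nat) \<Rightarrow> bool" where
  "labelling_at G v \<phi> \<longleftrightarrow>
     bij_betw \<phi> (verts G) {1..card (verts G)} \<and> \<phi> v = card (verts G)"

text \<open>The value does not depend on the labelling that is chosen.\<close>

definition chromatic_y_at :: "('a, 'b) pre_digraph \<Rightarrow> 'a \<Rightarrow> ubc_sym" where
  "chromatic_y_at G v = chromatic_y (relabel (SOME \<phi>. labelling_at G v \<phi>) G)"

definition e_positive_at :: "('a, 'b) pre_digraph \<Rightarrow> 'a \<Rightarrow> bool" where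
  "e_positive_at G v \<longleftrightarrow>
     (\<forall>t \<in> ubc_types (card (verts G)). Poly_Mapping.lookup (chromatic_y_at G v) t \<ge> 0)"

end

theory Submission
  imports Defs "HOL-Computational_Algebra.Polynomial"
begin

text \<open>
  Write \<open>Y\<^sub>G = \<Sum>\<^sub>\<pi> a\<^sub>\<pi> e\<^sub>\<pi>\<close>. Counting the colourings of \<open>G\<close> with \<open>q\<close> colours, and those in which the vertex \<open>d\<close>
  has a private extra colour, gives linear functionals that turn this into expansions of the
  chromatic polynomials of \<open>G\<close> and of \<open>G - v\<close> with coefficients
  \<open>c\<^bsub>(\<lambda>,b)\<^esub>\<close>, the coefficients of \<open>y\<^bsub>G:v\<^esub>\<close>. At \<open>q = -x\<close>, up to sign, they read
  \<open>\<Sum> c\<^bsub>(\<lambda>,b)\<^esub> x\<^bsup>(b)\<^esup> \<Prod>\<^sub>i x\<^bsup>(\<lambda>\<^sub>i)\<^esup>\<close> and \<open>\<Sum> c\<^bsub>(\<lambda>,b)\<^esub> x\<^bsup>(b-1)\<^esup> \<Prod>\<^sub>i x\<^bsup>(\<lambda>\<^sub>i)\<^esup>\<close> with rising factorials.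
  If all \<open>c\<^bsub>(\<lambda>,b)\<^esub>\<close> are nonnegative, the first sum is at most \<open>d\<close> times the second for \<open>0 \<le> x \<le> 1\<close>. But as
  \<open>x\<close> tends to \<open>0\<close>, the two are of the exact orders \<open>x\<^bsup>k\<^esup>\<close> and \<open>x\<^bsup>k'\<^esup>\<close>, where \<open>k\<close> and \<open>k'\<close> are the numbers of
  connected components of \<open>G\<close> and \<open>G - v\<close>; so \<open>k' \<le> k\<close>, and \<open>v\<close> is not a cut vertex.
\<close>

section \<open>Connected components\<close>

text \<open>Reachability in the graph \<open>(V, E)\<close>, characterised without paths. Edges leaving \<open>V\<close> are ignored,
  so deleting a vertex only changes \<open>V\<close>.\<close>

definition conn :: "'a set \<Rightarrow> ('a \<times> 'a) set \<Rightarrow> ('a \<times> 'a) set" where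
  "conn V E = {(u, w) \<in> V \<times> V. \<forall>f :: 'a \<Rightarrow> bool. (\<forall>(a, b) \<in> E \<inter> V \<times> V. f a = f b) \<longrightarrow> f u = f w}"

definition comps :: "'a set \<Rightarrow> ('a \<times> 'a) set \<Rightarrow> nat" where
  "comps V E = card (V // conn V E)"

lemma connI:
  assumes "u \<in> V" "w \<in> V"
    and "\<And>f :: 'a \<Rightarrow> bool. (\<And>a b. (a, b) \<in> E \<Longrightarrow> a \<in> V \<Longrightarrow> b \<in> V \<Longrightarrow> f a = f b) \<Longrightarrow> f u = f w"
  shows "(u, w) \<in> conn V E"
proof -
  have "f u = f w" if "\<forall>(a, b) \<in> E \<inter> V \<times> V. f a = f b" for f :: "'a \<Rightarrow> bool"
    by (rule assms(3)) (use that in fastforce)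
  then show ?thesis using assms(1,2) by (simp add: conn_def)
qed

text \<open>A definition cannot quantify over types, so \<open>conn\<close> tests Boolean labellings
  only. A labelling \<open>f\<close> with values in any type is reduced to these by asking whether a
  vertex has the same value as \<open>u\<close>.\<close>

lemma connD:
  assumes "(u, w) \<in> conn V E"
    and "\<And>a b. (a, b) \<in> E \<Longrightarrow> a \<in> V \<Longrightarrow> b \<in> V \<Longrightarrow> f a = f b"
  shows "f u = f w"
proof -
  have "\<forall>g :: 'a \<Rightarrow> bool. (\<forall>(a, b) \<in> E \<inter> V \<times> V. g a = g b) \<longrightarrow> g u = g w"
    using assms(1) by (simp add: conn_def)
  from spec[OF this, of "\<lambda>x. f x = f u"]
  have "(\<forall>(a, b) \<in> E \<inter> V \<times> V. (f a = f u) = (f b = f u)) \<longrightarrow> (f u = f u) = (f w = f u)" .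
  moreover have "\<forall>(a, b) \<in> E \<inter> V \<times> V. (f a = f u) = (f b = f u)"
    using assms(2) by fastforce
  ultimately show ?thesis by simp
qed

lemma conn_subset: "conn V E \<subseteq> V \<times> V"
  by (auto simp: conn_def)

lemma equiv_conn: "equiv V (conn V E)"
proof (rule equivI)
  show "refl_on V (conn V E)" by (auto intro: refl_onI connI)
  show "sym (conn V E)" by (rule symI) (simp add: conn_def eq_commute)
  show "trans (conn V E)"
  proof (rule transI, rule connI)
    fix x y z and f :: "'a \<Rightarrow> bool"
    assume xy: "(x, y) \<in> conn V E" and yz: "(y, z) \<in> conn V E"
      and f: "\<And>a b. (a, b) \<in> E \<Longrightarrow> a \<in> V \<Longrightarrow> b \<in> V \<Longrightarrow> f a = f b"
    show "f x = f z" using connD[OF xy, of f, OF f] connD[OF yz, of f, OF f] by simp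
  qed (use conn_subset in fast)+
qed (rule conn_subset)

lemma conn_base: "(a, b) \<in> E \<Longrightarrow> a \<in> V \<Longrightarrow> b \<in> V \<Longrightarrow> (a, b) \<in> conn V E"
  by (auto intro: connI)

lemma conn_mono:
  assumes "E \<inter> V \<times> V \<subseteq> conn V E'"
  shows "conn V E \<subseteq> conn V E'"
proof (safe, rule connI)
  fix u w and f :: "'a \<Rightarrow> bool"
  assume uw: "(u, w) \<in> conn V E" and f: "\<And>a b. (a, b) \<in> E' \<Longrightarrow> a \<in> V \<Longrightarrow> b \<in> V \<Longrightarrow> f a = f b"
  have "f a = f b" if "(a, b) \<in> E" "a \<in> V" "b \<in> V" for a b
  proof (rule connD[OF subsetD[OF assms]])
    show "(a, b) \<in> E \<inter> V \<times> V" using that by blast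
  qed (rule f)
  then show "f u = f w" by (rule connD[OF uw])
qed (use conn_subset in fast)+

text \<open>The image of a class under \<open>g\<close> may be only part of a class, but its
  saturation under \<open>S\<close> is a whole one, and this gives the bijection of quotients. It
  serves both for adding a vertex, with \<open>g = id\<close>, and for relabelling.\<close>

lemma card_quotient_eq:
  assumes R: "equiv A R" and S: "equiv B S" and g: "\<And>a. a \<in> A \<Longrightarrow> g a \<in> B"
    and iff: "\<And>a a'. a \<in> A \<Longrightarrow> a' \<in> A \<Longrightarrow> (g a, g a') \<in> S \<longleftrightarrow> (a, a') \<in> R"
    and sur: "\<And>b. b \<in> B \<Longrightarrow> \<exists>a\<in>A. (g a, b) \<in> S"
  shows "card (A // R) = card (B // S)"
proof -
  have h: "S `` (g ` (R `` {a})) = S `` {g a}" if a: "a \<in> A" for a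
  proof -
    have "(g a, x) \<in> S" if "(a, a') \<in> R" "(g a', x) \<in> S" for a' x
    proof -
      have "a' \<in> A" using that(1) equiv_type[OF R] by blast
      then have "(g a, g a') \<in> S" using iff a that by simp
      then show ?thesis using that(2) using S by (meson equivE transD)
    qed
    moreover have "(a, a) \<in> R" using equiv_class_self[OF R a] by simp
    ultimately show ?thesis by auto
  qed
  have "bij_betw (\<lambda>X. S `` (g ` X)) (A // R) (B // S)"
    unfolding bij_betw_def
  proof
    show "inj_on (\<lambda>X. S `` (g ` X)) (A // R)"
    proof (rule inj_onI, elim quotientE)
      fix X Y a b assume "X = R `` {a}" "Y = R `` {b}" "a \<in> A" "b \<in> A" "S `` (g ` X) = S `` (g ` Y)"
      then show "X = Y"
        by (simp add: h eq_equiv_class_iff[OF R] eq_equiv_class_iff[OF S] g iff)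
    qed
    show "(\<lambda>X. S `` (g ` X)) ` (A // R) = B // S"
    proof safe
      fix X assume "X \<in> A // R"
      then show "S `` (g ` X) \<in> B // S"
        by (auto elim!: quotientE simp: h intro!: quotientI g)
    next
      fix Y assume "Y \<in> B // S"
      then obtain b where b: "b \<in> B" "Y = S `` {b}" by (auto elim: quotientE)
      obtain a where a: "a \<in> A" "(g a, b) \<in> S" using sur b by blast
      have "Y = S `` (g ` (R `` {a}))"
        using a b S by (simp add: h equiv_class_eq_iff)
      then show "Y \<in> (\<lambda>X. S `` (g ` X)) ` (A // R)"
        using a by (auto intro: quotientI)
    qed
  qed
  then show ?thesis by (rule bij_betw_same_card)
qed

lemma comps_antimono:
  assumes "finite V" "E \<inter> V \<times> V \<subseteq> conn V E'"
  shows "comps V E' \<le> comps V E"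
  unfolding comps_def using assms
  by (intro finite_refines_card_le equiv_conn conn_mono) (auto intro!: finite_quotient conn_subset)

lemma comps_cong:
  assumes "conn V E = conn V E'"
  shows "comps V E = comps V E'"
  using assms by (simp add: comps_def)

lemma comps_empty [simp]: "comps {} E = 0"
  by (simp add: comps_def)

lemma comps_insert_isolated:
  assumes "finite V" "v \<notin> V" and E: "\<And>u. u \<in> V \<Longrightarrow> (u, v) \<notin> E \<and> (v, u) \<notin> E"
  shows "comps (insert v V) E = Suc (comps V E)"
proof -
  have conn: "conn (insert v V) E = insert (v, v) (conn V E)"
  proof safe
    fix u w assume uw: "(u, w) \<in> conn (insert v V) E" "(u, w) \<notin> conn V E"
    have "(u = v) = (w = v)"
      using uw(1) by (rule connD) (use E in auto)
    moreover have "(u, w) \<in> conn V E" if "u \<noteq> v" "w \<noteq> v"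
    proof (rule connI)
      fix f :: "'a \<Rightarrow> bool"
      assume f: "\<And>a b. (a, b) \<in> E \<Longrightarrow> a \<in> V \<Longrightarrow> b \<in> V \<Longrightarrow> f a = f b"
      show "f u = f w"
        using uw(1) by (rule connD) (use E f in auto)
    qed (use that uw conn_subset in fast)+
    ultimately show "u = v" "w = v" using uw by argo+
  next
    show "(v, v) \<in> conn (insert v V) E" by (auto intro: connI)
  next
    fix u w assume uw: "(u, w) \<in> conn V E"
    show "(u, w) \<in> conn (insert v V) E"
      by (rule connI, use uw conn_subset in fast, use uw conn_subset in fast)
        (rule connD[OF uw], blast)
  qed
  have "insert v V // conn (insert v V) E = insert {v} (V // conn V E)"
  proof -
    have "insert (v, v) (conn V E) `` {v} = {v}"
      using assms(2) conn_subset[of V E] by blast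
    moreover have "insert (v, v) (conn V E) `` {u} = conn V E `` {u}" if "u \<in> V" for u
      using assms(2) that by auto
    ultimately show ?thesis unfolding conn quotient_def by simp
  qed
  moreover have "{v} \<notin> V // conn V E"
    using assms(2) by (metis equiv_conn in_quotient_imp_subset insert_subset)
  ultimately show ?thesis
    using assms(1) by (simp add: comps_def finite_quotient conn_subset)
qed

text \<open>As far as connectivity is concerned, \<open>v\<close> merely joins its neighbours to
  each other, and a clique on \<open>N\<close> does the same. Since \<open>N\<close> is nonempty,
  \<open>v\<close> itself lies in the class of some vertex of \<open>V\<close>.\<close>

lemma comps_insert:
  assumes "v \<notin> V" and N: "N = {u \<in> V. (u, v) \<in> E \<or> (v, u) \<in> E}" and "N \<noteq> {}"
  shows "comps (insert v V) E = comps V (E \<union> N \<times> N)"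
  unfolding comps_def
proof (rule card_quotient_eq[symmetric, where g = id])
  obtain u0 where u0: "u0 \<in> N" using assms(3) by blast
  fix u w assume uw: "u \<in> V" "w \<in> V"
  show "(id u, id w) \<in> conn (insert v V) E \<longleftrightarrow> (u, w) \<in> conn V (E \<union> N \<times> N)"
  proof
    assume A: "(id u, id w) \<in> conn (insert v V) E"
    show "(u, w) \<in> conn V (E \<union> N \<times> N)"
    proof (rule connI)
      fix f :: "'a \<Rightarrow> bool"
      assume f: "\<And>a b. (a, b) \<in> E \<union> N \<times> N \<Longrightarrow> a \<in> V \<Longrightarrow> b \<in> V \<Longrightarrow> f a = f b"
      \<comment> \<open>The clique forces a common value on \<open>N\<close>; giving
        \<open>v\<close> this value extends the labelling consistently.\<close>
      have "(f(v := f u0)) (id u) = (f(v := f u0)) (id w)"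
      proof (rule connD[OF A])
        fix a b assume ab: "(a, b) \<in> E" "a \<in> insert v V" "b \<in> insert v V"
        have "f b = f u0" if "a = v" "b \<in> V" using f[of b u0] that u0 ab N by auto
        moreover have "f a = f u0" if "b = v" "a \<in> V" using f[of a u0] that u0 ab N by auto
        ultimately show "(f(v := f u0)) a = (f(v := f u0)) b"
          using ab f[of a b] by auto
      qed
      then show "f u = f w" using uw assms(1) by (auto split: if_splits)
    qed (use uw in auto)
  next
    assume A: "(u, w) \<in> conn V (E \<union> N \<times> N)"
    show "(id u, id w) \<in> conn (insert v V) E"
    proof (rule connI)
      fix f :: "'a \<Rightarrow> bool"
      assume f: "\<And>a b. (a, b) \<in> E \<Longrightarrow> a \<in> insert v V \<Longrightarrow> b \<in> insert v V \<Longrightarrow> f a = f b"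
      have "f a = f v" if "a \<in> N" for a using that N f[of a v] f[of v a] by auto
      then have "f u = f w" by (intro connD[OF A]) (use f in auto)
      then show "f (id u) = f (id w)" by simp
    qed (use uw in auto)
  qed
next
  obtain u0 where u0: "u0 \<in> N" using assms(3) by blast
  have u0v: "(u0, v) \<in> conn (insert v V) E"
  proof (rule connI)
    fix f :: "'a \<Rightarrow> bool"
    assume f: "\<And>a b. (a, b) \<in> E \<Longrightarrow> a \<in> insert v V \<Longrightarrow> b \<in> insert v V \<Longrightarrow> f a = f b"
    show "f u0 = f v" using f[of u0 v] f[of v u0] u0 N by auto
  qed (use u0 N in auto)
  fix b assume "b \<in> insert v V"
  then show "\<exists>a\<in>V. (id a, b) \<in> conn (insert v V) E"
    using u0v u0 N by (auto intro: connI)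
qed (auto simp: equiv_conn)

text \<open>Links the two sides of the recursion for colourings: the star keeps the graph loop-free,
  so that it can be coloured, while the clique is what \<open>comps_insert\<close> produces.\<close>

lemma comps_star:
  assumes "N \<subseteq> V" "u \<in> V"
  shows "comps V (E \<union> {u} \<times> N) = comps V (E \<union> insert u N \<times> insert u N)"
proof (intro comps_cong equalityI conn_mono)
  show "(E \<union> insert u N \<times> insert u N) \<inter> V \<times> V \<subseteq> conn V (E \<union> {u} \<times> N)"
  proof clarify
    fix a b assume "(a, b) \<in> E \<union> insert u N \<times> insert u N" "a \<in> V" "b \<in> V"
    then consider "(a, b) \<in> E" "a \<in> V" "b \<in> V" | "a \<in> insert u N" "b \<in> insert u N" "a \<in> V" "b \<in> V"
      by blast
    then show "(a, b) \<in> conn V (E \<union> {u} \<times> N)"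
    proof cases
      case 1
      then show ?thesis by (auto intro: conn_base)
    next
      case 2
      show ?thesis
      proof (rule connI)
        fix f :: "'a \<Rightarrow> bool"
        assume f: "\<And>a b. (a, b) \<in> E \<union> {u} \<times> N \<Longrightarrow> a \<in> V \<Longrightarrow> b \<in> V \<Longrightarrow> f a = f b"
        have "f u = f c" if "c \<in> insert u N" for c
          using f[of u c] that assms by (cases "c = u") auto
        then have "f u = f a" "f u = f b" using 2(1,2) by blast+
        then show "f a = f b" by simp
      qed (use 2 in auto)
    qed
  qed
qed (auto intro: conn_base)

section \<open>Chromatic polynomials at negative arguments\<close>

definition cols :: "'a set \<Rightarrow> ('a \<times> 'a) set \<Rightarrow> nat \<Rightarrow> ('a \<Rightarrow> nat) set" where
  "cols V E q = {\<kappa> \<in> V \<rightarrow>\<^sub>E {1..q}. \<forall>(u, w) \<in> E \<inter> V \<times> V. \<kappa> u \<noteq> \<kappa> w}"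

lemma colsI:
  assumes "\<kappa> \<in> V \<rightarrow>\<^sub>E {1..q}"
    and "\<And>u w. (u, w) \<in> E \<Longrightarrow> u \<in> V \<Longrightarrow> w \<in> V \<Longrightarrow> \<kappa> u \<noteq> \<kappa> w"
  shows "\<kappa> \<in> cols V E q"
  using assms unfolding cols_def by blast

lemma colsD:
  assumes "\<kappa> \<in> cols V E q"
  shows "\<kappa> \<in> V \<rightarrow>\<^sub>E {1..q}"
    and "(u, w) \<in> E \<Longrightarrow> u \<in> V \<Longrightarrow> w \<in> V \<Longrightarrow> \<kappa> u \<noteq> \<kappa> w"
  using assms unfolding cols_def by auto

lemma finite_cols: "finite V \<Longrightarrow> finite (cols V E q)"
  by (simp add: cols_def finite_PiE)

text \<open>The vertex \<open>u\<close> brings a new colour exactly when its colour occurs nowhere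
  on \<open>N\<close>, that is, when the colouring is also proper for the star from \<open>u\<close>
  to \<open>N\<close>.\<close>

lemma sum_cols_add_star:
  assumes "u \<in> V" "N \<subseteq> V" "finite V"
  shows "(\<Sum>\<kappa>\<in>cols V E q. card (\<kappa> ` insert u N))
    = (\<Sum>\<kappa>\<in>cols V E q. card (\<kappa> ` N)) + card (cols V (E \<union> {u} \<times> N) q)"
proof -
  have N: "finite N" using assms finite_subset by auto
  have "cols V (E \<union> {u} \<times> N) q = {\<kappa> \<in> cols V E q. \<kappa> u \<notin> \<kappa> ` N}"
    using assms by (auto simp: cols_def)
  then have "card (cols V (E \<union> {u} \<times> N) q) = (\<Sum>\<kappa>\<in>cols V E q. if \<kappa> u \<notin> \<kappa> ` N then 1 else 0)"
    by (simp add: finite_cols assms flip: sum.inter_filter)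
  then show ?thesis
    by (simp add: sum.distrib[symmetric] card_insert_if N) (intro sum.cong; auto)
qed

text \<open>A colouring of \<open>V\<close> extends to \<open>v\<close> by any colour that is absent
  from \<open>N\<close>. Working in \<open>int\<close> avoids truncated subtraction, so that the sum
  can later be split into two.\<close>

lemma card_cols_insert:
  assumes V: "finite V" "v \<notin> V" and loop: "(v, v) \<notin> E"
    and N: "N = {u \<in> V. (u, v) \<in> E \<or> (v, u) \<in> E}"
  shows "int (card (cols (insert v V) E q)) = (\<Sum>\<kappa>\<in>cols V E q. int q - int (card (\<kappa> ` N)))"
proof -
  have "bij_betw (\<lambda>(\<kappa>, c). \<kappa>(v := c)) (SIGMA \<kappa>:cols V E q. {1..q} - \<kappa> ` N) (cols (insert v V) E q)"
  \<comment> \<open>Colourings are extensional, so forgetting the colour of \<open>v\<close> means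
    resetting it to \<open>undefined\<close>.\<close>
  proof (rule bij_betw_byWitness[where f' = "\<lambda>\<kappa>. (\<kappa>(v := undefined), \<kappa> v)"], goal_cases)
    case 1
    have "\<kappa>(v := undefined) = \<kappa>" if "\<kappa> \<in> cols V E q" for \<kappa>
      using PiE_arb[OF colsD(1)[OF that] V(2)] by auto
    then show ?case by auto
  next
    case 2
    show ?case by auto
  next
    case 3
    show ?case
    proof clarify
      fix \<kappa> c assume \<kappa>: "\<kappa> \<in> cols V E q" and c: "c \<in> {1..q}" "c \<notin> \<kappa> ` N"
      show "\<kappa>(v := c) \<in> cols (insert v V) E q"
      proof (rule colsI)
        show "\<kappa>(v := c) \<in> insert v V \<rightarrow>\<^sub>E {1..q}"
          using colsD(1)[OF \<kappa>] c(1) by (rule PiE_fun_upd[rotated])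
        fix u w assume uw: "(u, w) \<in> E" "u \<in> insert v V" "w \<in> insert v V"
        have "\<kappa> u \<noteq> \<kappa> w" if "u \<in> V" "w \<in> V"
          using colsD(2)[OF \<kappa> uw(1) that] .
        moreover have "w \<in> N" if "u = v" "w \<in> V" using that uw(1) N by blast
        moreover have "u \<in> N" if "w = v" "u \<in> V" using that uw(1) N by blast
        ultimately show "(\<kappa>(v := c)) u \<noteq> (\<kappa>(v := c)) w"
          using uw c(2) loop V(2) by (metis fun_upd_apply image_eqI insertE)
      qed
    qed
  next
    case 4
    have "\<kappa>(v := undefined) \<in> cols V E q" if \<kappa>: "\<kappa> \<in> cols (insert v V) E q" for \<kappa>
    proof (rule colsI)
      show "\<kappa>(v := undefined) \<in> V \<rightarrow>\<^sub>E {1..q}"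
        using colsD(1)[OF \<kappa>] V(2) by (rule fun_upd_in_PiE[rotated])
      fix u w assume "(u, w) \<in> E" "u \<in> V" "w \<in> V"
      then show "(\<kappa>(v := undefined)) u \<noteq> (\<kappa>(v := undefined)) w"
        using colsD(2)[OF \<kappa>, of u w] V(2) by auto
    qed
    moreover have "\<kappa> v \<in> {1..q}" if "\<kappa> \<in> cols (insert v V) E q" for \<kappa>
      using colsD(1)[OF that] by (rule PiE_mem) simp
    moreover have "\<kappa> v \<noteq> \<kappa> u" if "\<kappa> \<in> cols (insert v V) E q" "u \<in> N" for \<kappa> u
      using colsD(2)[OF that(1), of u v] colsD(2)[OF that(1), of v u] that(2) N by auto
    moreover have "v \<notin> N" using N V(2) by blast
    ultimately show ?case by (force simp: image_iff)
  qed
  then have "card (cols (insert v V) E q) = card (SIGMA \<kappa>:cols V E q. {1..q} - \<kappa> ` N)"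
    by (metis bij_betw_same_card)
  also have "\<dots> = (\<Sum>\<kappa>\<in>cols V E q. card ({1..q} - \<kappa> ` N))"
    using V by (simp add: finite_cols card_SigmaI)
  finally have "int (card (cols (insert v V) E q)) = (\<Sum>\<kappa>\<in>cols V E q. int (card ({1..q} - \<kappa> ` N)))"
    by simp
  also have "\<dots> = (\<Sum>\<kappa>\<in>cols V E q. int q - int (card (\<kappa> ` N)))"
  proof (rule sum.cong)
    fix \<kappa> assume "\<kappa> \<in> cols V E q"
    then have sub: "\<kappa> ` N \<subseteq> {1..q}" using N by (auto simp: cols_def)
    then have "card (\<kappa> ` N) \<le> q" using card_mono[OF _ sub] by simp
    then show "int (card ({1..q} - \<kappa> ` N)) = int q - int (card (\<kappa> ` N))"
      using sub by (simp add: card_Diff_subset finite_subset)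
  qed simp
  finally show ?thesis .
qed


lemma poly_eq_if_eq_on_nat:
  fixes p r :: "'a :: {idom, ring_char_0} poly"
  assumes "\<And>q. poly p (of_nat q) = poly r (of_nat q)"
  shows "p = r"
proof (rule ccontr)
  assume "p \<noteq> r"
  then have "finite {x. poly (p - r) x = 0}" by (intro poly_roots_finite) simp
  moreover have "range of_nat \<subseteq> {x. poly (p - r) x = 0}" using assms by auto
  ultimately show False
    using infinite_UNIV_nat finite_imageD[of of_nat UNIV] inj_of_nat finite_subset by blast
qed

text \<open>Colouring \<open>v\<close> last, its neighbours \<open>N\<close> block \<open>card (\<kappa> ` N)\<close> colours. Listing the neighbours one
  by one, this number counts those whose colour differs from the colours of the earlier ones, i.e.
  proper colourings of the graph with a star added inside \<open>N\<close>. At \<open>- x\<close> all terms of the resulting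
  recursion have the same sign, so both bounds follow by induction.\<close>

theorem chromatic_polynomial_bounds:
  assumes "finite V" and "\<And>u. (u, u) \<notin> E"
  shows "\<exists>(p :: rat poly) C. (\<forall>q. poly p (of_nat q) = of_nat (card (cols V E q))) \<and>
    (\<forall>x. 0 \<le> x \<longrightarrow> x \<le> 1 \<longrightarrow> x ^ comps V E \<le> (-1) ^ card V * poly p (- x) \<and>
      (-1) ^ card V * poly p (- x) \<le> C * x ^ comps V E)"
  using assms
proof (induction V arbitrary: E rule: finite_induct)
  case empty
  have "cols {} E q = {\<lambda>_. undefined}" for q by (auto simp: cols_def)
  then show ?case by (intro exI[of _ 1]) auto
next
  case (insert v V)
  define N where "N = {u \<in> V. (u, v) \<in> E \<or> (v, u) \<in> E}"
  note IH = insert.IH and loop = insert.prems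
  obtain p C where p: "\<And>q. poly p (of_nat q) = (of_nat (card (cols V E q)) :: rat)"
    and p_lower: "\<And>x. 0 \<le> x \<Longrightarrow> x \<le> 1 \<Longrightarrow> x ^ comps V E \<le> (-1) ^ card V * poly p (- x)"
    and p_upper: "\<And>x. 0 \<le> x \<Longrightarrow> x \<le> 1 \<Longrightarrow> (-1) ^ card V * poly p (- x) \<le> C * x ^ comps V E"
    using insert.IH[of E] insert.prems by meson
  \<comment> \<open>At \<open>x = 1\<close> the two bounds read \<open>1 \<le> C\<close> when
    combined.\<close>
  have C: "C \<ge> 0" using p_lower[of 1] p_upper[of 1] by simp
  have "finite N" "N \<subseteq> V" using insert.hyps by (auto simp: N_def)
  \<comment> \<open>Of \<open>N\<close> only finiteness and \<open>N \<subseteq> V\<close> are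
    retained, so that it can grow from the empty set. There the sum is zero and the lower bound
    fails; hence the guard \<open>N \<noteq> {}\<close> and the separate claim of
    nonnegativity.\<close>
  then have "\<exists>(r :: rat poly) D. (\<forall>q. poly r (of_nat q) = of_nat (\<Sum>\<kappa>\<in>cols V E q. card (\<kappa> ` N))) \<and> D \<ge> 0 \<and>
      (\<forall>x. 0 \<le> x \<longrightarrow> x \<le> 1 \<longrightarrow>
        (N \<noteq> {} \<longrightarrow> x ^ comps V (E \<union> N \<times> N) \<le> (-1) ^ card V * poly r (- x)) \<and>
        0 \<le> (-1) ^ card V * poly r (- x) \<and>
        (-1) ^ card V * poly r (- x) \<le> D * x ^ comps V (E \<union> N \<times> N))"
  proof (induction N rule: finite_induct)
    case empty
    show ?case by (intro exI[of _ 0]) simp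
  next
    case (insert u N)
    let ?k = "comps V (E \<union> insert u N \<times> insert u N)" and ?l = "comps V (E \<union> N \<times> N)"
    obtain r D where r: "\<forall>q. poly r (of_nat q) = (of_nat (\<Sum>\<kappa>\<in>cols V E q. card (\<kappa> ` N)) :: rat)"
      and D: "D \<ge> 0" and r_bounds: "\<forall>x. 0 \<le> x \<longrightarrow> x \<le> 1 \<longrightarrow>
        (N \<noteq> {} \<longrightarrow> x ^ ?l \<le> (-1) ^ card V * poly r (- x)) \<and>
        0 \<le> (-1) ^ card V * poly r (- x) \<and> (-1) ^ card V * poly r (- x) \<le> D * x ^ ?l"
      using insert.IH insert.prems by blast
    have r_nonneg: "0 \<le> (-1) ^ card V * poly r (- x)"
      and r_upper: "(-1) ^ card V * poly r (- x) \<le> D * x ^ ?l" if "0 \<le> x" "x \<le> 1" for x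
      using spec[OF r_bounds, of x] that by simp_all
    have star: "comps V (E \<union> {u} \<times> N) = ?k"
      using insert.prems by (intro comps_star) auto
    have "(w, w) \<notin> E \<union> {u} \<times> N" for w
      using insert.hyps(2) loop by auto
    \<comment> \<open>The outer induction hypothesis holds for every loop-free edge set on
      \<open>V\<close>, in particular with the star added; \<open>star\<close> turns its exponent
      into that of the clique.\<close>
    from IH[OF this, unfolded star] obtain p' C'
      where p': "\<forall>q. poly p' (of_nat q) = (of_nat (card (cols V (E \<union> {u} \<times> N) q)) :: rat)"
        and p'_bounds: "\<forall>x. 0 \<le> x \<longrightarrow> x \<le> 1 \<longrightarrow> x ^ ?k \<le> (-1) ^ card V * poly p' (- x) \<and>
          (-1) ^ card V * poly p' (- x) \<le> C' * x ^ ?k"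
      by blast
    have p'_lower: "x ^ ?k \<le> (-1) ^ card V * poly p' (- x)"
      and p'_upper: "(-1) ^ card V * poly p' (- x) \<le> C' * x ^ ?k" if "0 \<le> x" "x \<le> 1" for x
      using spec[OF p'_bounds, of x] that by simp_all
    have C': "C' \<ge> 0" using p'_lower[of 1] p'_upper[of 1] by simp
    have le: "?k \<le> ?l"
      using \<open>finite V\<close> by (intro comps_antimono) (auto intro: conn_base)
    show ?case
    proof (intro exI conjI allI impI)
      show "poly (r + p') (of_nat q) = of_nat (\<Sum>\<kappa>\<in>cols V E q. card (\<kappa> ` insert u N))" for q
        using sum_cols_add_star[of u V N E q] insert.prems \<open>finite V\<close> spec[OF r, of q] spec[OF p', of q] by simp
      show "0 \<le> D + C'" using C' D by simp
      fix x :: rat assume x: "0 \<le> x" "x \<le> 1"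
      have eq: "(-1) ^ card V * poly (r + p') (- x) = (-1) ^ card V * poly r (- x) + (-1) ^ card V * poly p' (- x)"
        by (simp add: algebra_simps)
      show lower: "x ^ ?k \<le> (-1) ^ card V * poly (r + p') (- x)"
        using p'_lower[OF x] r_nonneg[OF x] unfolding eq by linarith
      show "0 \<le> (-1) ^ card V * poly (r + p') (- x)"
        using lower zero_le_power[OF x(1), of ?k] by linarith
      have "D * x ^ ?l \<le> D * x ^ ?k"
        using power_decreasing[OF le x] D by (rule mult_left_mono)
      then show "(-1) ^ card V * poly (r + p') (- x) \<le> (D + C') * x ^ ?k"
        using p'_upper[OF x] r_upper[OF x] unfolding eq distrib_right by linarith
    qed
  qed
  then obtain r D where r: "\<forall>q. poly r (of_nat q) = (of_nat (\<Sum>\<kappa>\<in>cols V E q. card (\<kappa> ` N)) :: rat)"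
    and D: "D \<ge> 0"
    and r_bounds: "\<forall>x. 0 \<le> x \<longrightarrow> x \<le> 1 \<longrightarrow>
        (N \<noteq> {} \<longrightarrow> x ^ comps V (E \<union> N \<times> N) \<le> (-1) ^ card V * poly r (- x)) \<and>
        0 \<le> (-1) ^ card V * poly r (- x) \<and>
        (-1) ^ card V * poly r (- x) \<le> D * x ^ comps V (E \<union> N \<times> N)"
    by blast
  have r_lower: "N \<noteq> {} \<Longrightarrow> x ^ comps V (E \<union> N \<times> N) \<le> (-1) ^ card V * poly r (- x)"
    and r_nonneg: "0 \<le> (-1) ^ card V * poly r (- x)"
    and r_upper: "(-1) ^ card V * poly r (- x) \<le> D * x ^ comps V (E \<union> N \<times> N)"
    if "0 \<le> x" "x \<le> 1" for x
    using spec[OF r_bounds, of x] that by simp_all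
  \<comment> \<open>The polynomial form of \<open>card_cols_insert\<close>, with
    \<open>[:0, 1:]\<close> for the number of colours. At \<open>- x\<close> the sign of this factor
    cancels the sign from the additional vertex, so both terms of \<open>P\<close> enter with a
    plus.\<close>
  let ?P = "[:0, 1:] * p - r"
  have P: "(-1) ^ card (insert v V) * poly ?P (- x)
      = x * ((-1) ^ card V * poly p (- x)) + (-1) ^ card V * poly r (- x)" for x
    using insert.hyps by (simp add: algebra_simps)
  show ?case
  proof (intro exI conjI allI impI)
    fix q
    have "(of_int (int (card (cols (insert v V) E q))) :: rat)
        = of_int (\<Sum>\<kappa>\<in>cols V E q. int q - int (card (\<kappa> ` N)))"
      using insert.hyps insert.prems by (subst card_cols_insert[OF _ _ _ N_def]) auto
    then show "poly ?P (of_nat q) = of_nat (card (cols (insert v V) E q))"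
      using p[of q] spec[OF r, of q] by (simp add: sum_subtractf algebra_simps)
  next
    fix x :: rat assume x: "0 \<le> x" "x \<le> 1"
    \<comment> \<open>Two cases for the order in \<open>x\<close>. Without neighbours,
      \<open>r\<close> vanishes and the factor \<open>x\<close> in front of \<open>p\<close> matches
      the additional component. With neighbours, \<open>r\<close> already has the right order, and
      the term with \<open>p\<close> is of at least that order because the clique on
      \<open>N\<close> can only merge components.\<close>
    have isolated: "comps (insert v V) E = Suc (comps V E)" if "N = {}"
      using that insert.hyps by (intro comps_insert_isolated) (auto simp: N_def)
    have joined: "comps (insert v V) E = comps V (E \<union> N \<times> N)" if "N \<noteq> {}"
      using insert.hyps(2) N_def that by (rule comps_insert)
    have pos: "0 \<le> (-1) ^ card V * poly p (- x)"
      using p_lower[OF x] zero_le_power[OF x(1), of "comps V E"] by linarith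
    show "x ^ comps (insert v V) E \<le> (-1) ^ card (insert v V) * poly ?P (- x)"
    proof (cases "N = {}")
      case True
      then show ?thesis
        using mult_left_mono[OF p_lower[OF x] x(1)] r_nonneg[OF x] unfolding P isolated[OF True] by simp
    next
      case False
      then show ?thesis
        using r_lower[OF x False] mult_nonneg_nonneg[OF x(1) pos] unfolding P joined[OF False] by simp
    qed
    have le: "comps (insert v V) E \<le> comps V (E \<union> N \<times> N)" if "N \<noteq> {}"
      using joined[OF that] by simp
    show "(-1) ^ card (insert v V) * poly ?P (- x) \<le> (C + D) * x ^ comps (insert v V) E"
    proof (cases "N = {}")
      case True
      have "poly r (of_nat q) = 0" for q using spec[OF r, of q] True by simp
      then have "r = 0" by (intro poly_eq_if_eq_on_nat) simp
      moreover have "0 \<le> D * (x * x ^ comps V E)" using x D by simp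
      ultimately show ?thesis
        using mult_left_mono[OF p_upper[OF x] x(1)] unfolding P isolated[OF True]
        by (simp add: algebra_simps)
    next
      case False
      have "comps V (E \<union> N \<times> N) \<le> comps V E"
        using \<open>finite V\<close> by (intro comps_antimono) (auto intro: conn_base)
      then have "C * x ^ comps V E \<le> C * x ^ comps V (E \<union> N \<times> N)"
        using x C by (intro mult_left_mono power_decreasing) auto
      moreover have "x * ((-1) ^ card V * poly p (- x)) \<le> 1 * ((-1) ^ card V * poly p (- x))"
        using x(2) pos by (rule mult_right_mono)
      ultimately show ?thesis
        using p_upper[OF x] r_upper[OF x] unfolding P joined[OF False] distrib_right by linarith
    qed
  qed
qed

section \<open>The elementary basis of NCSym\<close>

text \<open>Positions are counted from 1, to agree with the vertex set
  \<open>{1..d}\<close>.\<close>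

definition letter :: "nat list \<Rightarrow> nat \<Rightarrow> nat" where
  "letter w i = w ! (i - 1)"

definition nc_words :: "nat \<Rightarrow> nat list set" where
  "nc_words d = {w. length w = d \<and> 0 \<notin> set w}"

lemma letter_map: "i \<in> {1..d} \<Longrightarrow> letter (map \<kappa> [1..<Suc d]) i = \<kappa> i"
  by (auto simp: letter_def simp del: upt_Suc)

lemma map_letter: "length w = d \<Longrightarrow> map (letter w) [1..<Suc d] = w"
  by (intro nth_equalityI) (auto simp: letter_def simp del: upt_Suc)

lemma letter_pos: "w \<in> nc_words d \<Longrightarrow> i \<in> {1..d} \<Longrightarrow> letter w i > 0"
proof -
  assume "w \<in> nc_words d" "i \<in> {1..d}"
  then have "w ! (i - 1) \<in> set w" "0 \<notin> set w" by (auto simp: nc_words_def)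
  then show "letter w i > 0" unfolding letter_def by (metis gr0I)
qed

lemma map_in_nc_words: "\<kappa> \<in> {1..d} \<rightarrow> {0<..} \<Longrightarrow> map \<kappa> [1..<Suc d] \<in> nc_words d"
  by (force simp: nc_words_def)

text \<open>One family for all series involved: edges as \<open>D\<close> give the chromatic series,
  and an equivalence relation \<open>\<sigma>\<close> gives the power sum function as
  \<open>R = \<sigma>\<close>, \<open>D = {}\<close> and the elementary one as
  \<open>R = {}\<close>, \<open>D = \<sigma> - Id\<close>. Taking \<open>R = \<sigma>\<close> and
  its complement as \<open>D\<close> gives the monomial one.\<close>

definition kernel_series :: "nat \<Rightarrow> (nat \<times> nat) set \<Rightarrow> (nat \<times> nat) set \<Rightarrow> nc_series" where
  "kernel_series d R D = (\<lambda>w. of_bool (w \<in> nc_words d \<and>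
     (\<forall>(i, j) \<in> R. letter w i = letter w j) \<and> (\<forall>(i, j) \<in> D. letter w i \<noteq> letter w j)))"

text \<open>A word is spelled by at most one extensional map on \<open>{1..d}\<close>, so every
  coefficient is 0 or 1.\<close>

lemma nc_monomial_sum_eq_kernel_series:
  assumes D: "D \<subseteq> {1..d} \<times> {1..d}"
  shows "nc_monomial_sum d {\<kappa> \<in> {1..d} \<rightarrow>\<^sub>E {0<..}. \<forall>(i, j) \<in> D. \<kappa> i \<noteq> \<kappa> j} = kernel_series d {} D"
    (is "nc_monomial_sum d ?K = _")
proof
  fix w
  have inD: "i \<in> {1..d}" "j \<in> {1..d}" if "(i, j) \<in> D" for i j
    using subsetD[OF D that] by simp_all
  have "{\<kappa> \<in> ?K. map \<kappa> [1..<Suc d] = w}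
      = (if w \<in> nc_words d \<and> (\<forall>(i, j) \<in> D. letter w i \<noteq> letter w j)
         then {restrict (letter w) {1..d}} else {})" (is "?L = (if ?c then _ else _)")
  proof (cases ?c)
    case True
    have "\<kappa> = restrict (letter w) {1..d}" if "\<kappa> \<in> ?L" for \<kappa>
    proof
      fix i
      have \<kappa>: "\<kappa> \<in> {1..d} \<rightarrow>\<^sub>E {0<..}" and w: "map \<kappa> [1..<Suc d] = w"
        using that by blast+
      show "\<kappa> i = restrict (letter w) {1..d} i"
        using letter_map[of i d \<kappa>] PiE_arb[OF \<kappa>, of i] unfolding w by (cases "i \<in> {1..d}") simp_all
    qed
    moreover have "restrict (letter w) {1..d} \<in> ?L"
    proof -
      have "map (restrict (letter w) {1..d}) [1..<Suc d] = map (letter w) [1..<Suc d]"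
        by (rule map_cong) auto
      also have "\<dots> = w" using True by (intro map_letter) (simp add: nc_words_def)
      finally have "map (restrict (letter w) {1..d}) [1..<Suc d] = w" .
      moreover have "restrict (letter w) {1..d} \<in> {1..d} \<rightarrow>\<^sub>E {0<..}"
        using True letter_pos[of w d] by (simp add: restrict_PiE_iff)
      moreover have "\<forall>(i, j) \<in> D. restrict (letter w) {1..d} i \<noteq> restrict (letter w) {1..d} j"
      proof clarify
        fix i j assume ij: "(i, j) \<in> D"
          and "restrict (letter w) {1..d} i = restrict (letter w) {1..d} j"
        then have "letter w i = letter w j" using inD[OF ij] by simp
        then show False using True ij by auto
      qed
      ultimately show ?thesis by blast
    qed
    ultimately have "?L = {restrict (letter w) {1..d}}" by blast
    then show ?thesis using True by simp
  next
    case False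
    have none: "\<kappa> \<notin> ?L" for \<kappa>
    proof
      assume "\<kappa> \<in> ?L"
      then have \<kappa>: "\<kappa> \<in> {1..d} \<rightarrow>\<^sub>E {0<..}" "\<forall>(i, j) \<in> D. \<kappa> i \<noteq> \<kappa> j"
        and w: "map \<kappa> [1..<Suc d] = w" by blast+
      then have "w \<in> nc_words d" using map_in_nc_words[of \<kappa> d] by (auto simp: PiE_def)
      moreover have "letter w i \<noteq> letter w j" if "(i, j) \<in> D" for i j
        using \<kappa>(2) that inD[OF that] letter_map[of i d \<kappa>] letter_map[of j d \<kappa>] unfolding w by auto
      ultimately show False using False by auto
    qed
    have "?L = {}" using none by blast
    then show ?thesis using False by (simp only: if_False)
  qed
  then show "nc_monomial_sum d ?K w = kernel_series d {} D w"
    by (simp add: nc_monomial_sum_def kernel_series_def)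
qed

text \<open>Deletion and contraction: a word satisfies an inequality exactly if it does not satisfy
  the equality. Iterating this removes all of \<open>D\<close>.\<close>

lemma kernel_series_split:
  "kernel_series d R (insert (i, j) D) = kernel_series d R D - kernel_series d (insert (i, j) R) D"
  by (auto simp: kernel_series_def fun_eq_iff)

lemma kernel_series_in_span:
  assumes "finite D" "D \<subseteq> I \<times> I" "R \<subseteq> I \<times> I"
  shows "kernel_series d R D \<in> nc.span ((\<lambda>R. kernel_series d R {}) ` Pow (I \<times> I))"
  using assms
proof (induction D arbitrary: R rule: finite_induct)
  case empty
  then show ?case by (auto intro: nc.span_base)
next
  case (insert x D)
  obtain i j where x: "x = (i, j)" by fastforce
  show ?case
    unfolding x kernel_series_split using insert x by (intro nc.span_diff insert.IH) auto
qed

text \<open>Equality of letters propagates along paths, so only the equivalence relation generated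
  by \<open>R\<close> matters.\<close>

lemma kernel_series_conn:
  assumes R: "R \<subseteq> {1..d} \<times> {1..d}"
  shows "kernel_series d R {} = kernel_series d (conn {1..d} R) {}"
proof -
  have "(\<forall>(i, j) \<in> R. letter w i = letter w j) \<longleftrightarrow> (\<forall>(i, j) \<in> conn {1..d} R. letter w i = letter w j)" for w
  proof
    assume eq: "\<forall>(i, j) \<in> R. letter w i = letter w j"
    show "\<forall>(i, j) \<in> conn {1..d} R. letter w i = letter w j"
      by (clarify, erule connD) (use eq in auto)
  next
    assume eq: "\<forall>(i, j) \<in> conn {1..d} R. letter w i = letter w j"
    show "\<forall>(i, j) \<in> R. letter w i = letter w j"
    proof clarify
      fix i j assume ij: "(i, j) \<in> R"
      have "(i, j) \<in> conn {1..d} R" using R ij by (intro conn_base) auto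
      then show "letter w i = letter w j" using eq by auto
    qed
  qed
  then show ?thesis by (simp add: kernel_series_def)
qed

section \<open>Expansion of elementary functions over forests\<close>

lemma sum_nc_apply: "(\<Sum>x\<in>A. F x) w = (\<Sum>x\<in>A. F x w)" for F :: "'b \<Rightarrow> nc_series"
  by (induction A rule: infinite_finite_induct) auto

text \<open>The descending maps whose fibres stay in the classes of \<open>\<sigma>\<close>; they encode the forests in
  which every parent is smaller than its children.\<close>

definition parent_maps :: "nat \<Rightarrow> (nat \<times> nat) set \<Rightarrow> (nat \<Rightarrow> nat) set" where
  "parent_maps d \<sigma> = (\<Pi>\<^sub>E i\<in>{1..d}. {j. (j, i) \<in> \<sigma> \<and> j \<le> i})"

abbreviation parent_graph :: "nat \<Rightarrow> (nat \<Rightarrow> nat) \<Rightarrow> (nat \<times> nat) set" where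
  "parent_graph d f \<equiv> (\<lambda>i. (f i, i)) ` {1..d}"

lemma finite_parent_maps: "finite (parent_maps d \<sigma>)"
  unfolding parent_maps_def by (intro finite_PiE) (auto intro: finite_subset[OF _ finite_atMost])

text \<open>Colouring the vertices in increasing order, vertex \<open>i\<close> has to avoid the colours of the earlier
  members of its class; these are pairwise different, so the factor
  \<open>1 - (\<Sum>j<i. [letter w j = letter w i])\<close> is the indicator of this event.\<close>

lemma kernel_series_expand:
  assumes \<sigma>: "equiv {1..d} \<sigma>"
  shows "kernel_series d {} (\<sigma> - Id)
    = (\<Sum>f\<in>parent_maps d \<sigma>. nc_scale ((-1) ^ card {i \<in> {1..d}. f i \<noteq> i}) (kernel_series d (parent_graph d f) {}))"
proof
  fix w
  let ?B = "\<lambda>i. {j. (j, i) \<in> \<sigma> \<and> j \<le> i}"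
  \<comment> \<open>The choice \<open>j = i\<close> makes \<open>i\<close> a root, and a smaller
    \<open>j\<close> becomes its parent. Expanding the product of the sums of \<open>g i j\<close>
    therefore runs over the parent maps.\<close>
  define g :: "nat \<Rightarrow> nat \<Rightarrow> rat" where
    "g = (\<lambda>i j. if j = i then 1 else - of_bool (letter w j = letter w i))"
  have sub: "\<sigma> \<subseteq> {1..d} \<times> {1..d}" using \<sigma> by (rule equiv_type)
  have fin: "finite (?B i)" for i by (auto intro: finite_subset[OF _ finite_atMost])
  have refl: "(i, i) \<in> \<sigma>" if "i \<in> {1..d}" for i using \<sigma> that by (meson equivE refl_onD)
  have factor: "(\<Sum>j\<in>?B i. g i j) = 1 - of_nat (card {j. (j, i) \<in> \<sigma> \<and> j < i \<and> letter w j = letter w i})"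
    if "i \<in> {1..d}" for i
  proof -
    have eq: "?B i = insert i {j. (j, i) \<in> \<sigma> \<and> j < i}" using refl[OF that] by auto
    have fin': "finite {j. (j, i) \<in> \<sigma> \<and> j < i}" by (auto intro: finite_subset[OF _ finite_atMost])
    have "(\<Sum>j\<in>?B i. g i j) = 1 + (\<Sum>j | (j, i) \<in> \<sigma> \<and> j < i. - of_bool (letter w j = letter w i))"
      unfolding eq using fin' by (simp add: g_def)
    also have "(\<Sum>j | (j, i) \<in> \<sigma> \<and> j < i. - of_bool (letter w j = letter w i) :: rat)
        = - of_nat (card ({j. (j, i) \<in> \<sigma> \<and> j < i} \<inter> {j. letter w j = letter w i}))"
      using fin' by (simp add: sum_negf of_bool_def sum.If_cases)
    also have "{j. (j, i) \<in> \<sigma> \<and> j < i} \<inter> {j. letter w j = letter w i}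
        = {j. (j, i) \<in> \<sigma> \<and> j < i \<and> letter w j = letter w i}" by auto
    finally show ?thesis by simp
  qed
  have prod: "(\<Prod>i\<in>{1..d}. \<Sum>j\<in>?B i. g i j) = of_bool (\<forall>(i, j) \<in> \<sigma> - Id. letter w i \<noteq> letter w j)"
  proof (cases "\<forall>(i, j) \<in> \<sigma> - Id. letter w i \<noteq> letter w j")
    case True
    then have none: "{j. (j, i) \<in> \<sigma> \<and> j < i \<and> letter w j = letter w i} = {}" for i by auto
    have "(\<Sum>j\<in>?B i. g i j) = 1" if "i \<in> {1..d}" for i
      unfolding factor[OF that] none by simp
    then show ?thesis using True by simp
  next
    case False
    define bad where "bad = (\<lambda>i. \<exists>j. (j, i) \<in> \<sigma> \<and> j < i \<and> letter w j = letter w i)"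
    obtain a b where "(a, b) \<in> \<sigma>" "a \<noteq> b" "letter w a = letter w b" using False by auto
    moreover from this have "(b, a) \<in> \<sigma>" using \<sigma> by (meson equivE symD)
    ultimately have ex: "\<exists>i. bad i" unfolding bad_def by (metis linorder_neqE_nat)
    \<comment> \<open>Below the least bad vertex the letters within a class are pairwise different,
      so exactly one \<open>j\<close> agrees with \<open>i\<close> and its factor is
      \<open>1 - 1 = 0\<close>. At a later bad vertex the factor could be negative.\<close>
    define i where "i = (LEAST i. bad i)"
    have i: "bad i" unfolding i_def using ex by (rule LeastI_ex)
    have least: "\<not> bad k" if "k < i" for k using that not_less_Least unfolding i_def by blast
    obtain j where j: "(j, i) \<in> \<sigma>" "j < i" "letter w j = letter w i" using i bad_def by auto
    have uniq: "j' = j" if j': "(j', i) \<in> \<sigma>" "j' < i" "letter w j' = letter w i" for j'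
    proof (rule ccontr)
      assume "j' \<noteq> j"
      moreover have "(j', j) \<in> \<sigma>" "(j, j') \<in> \<sigma>"
        using \<sigma> j(1) j'(1) by (meson equivE symD transD)+
      ultimately have "bad (max j j')"
        using j j' unfolding bad_def by (metis linorder_neqE_nat max.strict_order_iff max.commute)
      then show False using least[of "max j j'"] j j' by simp
    qed
    have "{j. (j, i) \<in> \<sigma> \<and> j < i \<and> letter w j = letter w i} = {j}" using j uniq by blast
    moreover have "i \<in> {1..d}" using j(1) sub by auto
    ultimately have "(\<Sum>j\<in>?B i. g i j) = 0" using factor by simp
    then have "(\<Prod>i\<in>{1..d}. \<Sum>j\<in>?B i. g i j) = 0"
      using \<open>i \<in> {1..d}\<close> by (intro prod_zero) auto
    moreover have "of_bool (\<forall>(i, j) \<in> \<sigma> - Id. letter w i \<noteq> letter w j) = (0 :: rat)"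
      using False by (simp only: of_bool_eq)
    ultimately show ?thesis by (rule trans[OF _ sym])
  qed
  have summand: "(\<Prod>i\<in>{1..d}. g i (f i))
      = (-1) ^ card {i \<in> {1..d}. f i \<noteq> i} * of_bool (\<forall>(i, j) \<in> parent_graph d f. letter w i = letter w j)" for f
  proof -
    have "(\<Prod>i\<in>{1..d}. g i (f i))
        = (\<Prod>i\<in>{1..d}. (if f i \<noteq> i then -1 else 1) * of_bool (letter w (f i) = letter w i))"
      by (rule prod.cong) (auto simp: g_def)
    also have "\<dots> = (\<Prod>i\<in>{1..d}. if f i \<noteq> i then -1 else 1) * (\<Prod>i\<in>{1..d}. of_bool (letter w (f i) = letter w i))"
      by (rule prod.distrib)
    also have "(\<Prod>i\<in>{1..d}. if f i \<noteq> i then -1 else 1 :: rat) = (-1) ^ card {i \<in> {1..d}. f i \<noteq> i}"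
      by (simp add: prod.If_cases Int_def)
    also have "(\<Prod>i\<in>{1..d}. of_bool (letter w (f i) = letter w i) :: rat)
        = of_bool (\<forall>(i, j) \<in> parent_graph d f. letter w i = letter w j)"
    proof (cases "\<forall>i\<in>{1..d}. letter w (f i) = letter w i")
      case False
      then have "(\<Prod>i\<in>{1..d}. of_bool (letter w (f i) = letter w i) :: rat) = 0"
        by (intro prod_zero) auto
      then show ?thesis using False by auto
    qed simp
    finally show ?thesis .
  qed
  have "kernel_series d {} (\<sigma> - Id) w = of_bool (w \<in> nc_words d) * (\<Prod>i\<in>{1..d}. \<Sum>j\<in>?B i. g i j)"
    unfolding prod kernel_series_def by simp
  also have "(\<Prod>i\<in>{1..d}. \<Sum>j\<in>?B i. g i j) = (\<Sum>f\<in>parent_maps d \<sigma>. \<Prod>i\<in>{1..d}. g i (f i))"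
    unfolding parent_maps_def using fin by (intro prod_sum_PiE) auto
  finally show "kernel_series d {} (\<sigma> - Id) w
    = (\<Sum>f\<in>parent_maps d \<sigma>. nc_scale ((-1) ^ card {i \<in> {1..d}. f i \<noteq> i}) (kernel_series d (parent_graph d f) {})) w"
    unfolding summand sum_nc_apply sum_distrib_left
    by (simp add: nc_scale_def kernel_series_def)
qed

lemma parent_mapsD:
  assumes "f \<in> parent_maps d \<sigma>" "i \<in> {1..d}"
  shows "(f i, i) \<in> \<sigma>" "f i \<le> i"
  using PiE_mem[OF assms(1)[unfolded parent_maps_def] assms(2)] by simp_all

text \<open>If the forest of \<open>f\<close> spans the classes of \<open>\<sigma>\<close>, then its roots are the class minima. So these
  forests all contribute with the same sign.\<close>

lemma parent_maps_nonroots: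
  assumes \<sigma>: "equiv {1..d} \<sigma>" and f: "f \<in> parent_maps d \<sigma>" and conn: "conn {1..d} (parent_graph d f) = \<sigma>"
  shows "{i \<in> {1..d}. f i \<noteq> i} = {i. \<exists>j<i. (j, i) \<in> \<sigma>}"
proof (intro equalityI subsetI)
  fix i assume "i \<in> {i \<in> {1..d}. f i \<noteq> i}"
  then show "i \<in> {i. \<exists>j<i. (j, i) \<in> \<sigma>}"
    using parent_mapsD[OF f, of i] by (auto intro!: exI[of _ "f i"])
next
  fix i assume "i \<in> {i. \<exists>j<i. (j, i) \<in> \<sigma>}"
  then obtain j where j: "j < i" "(j, i) \<in> \<sigma>" by auto
  have sub: "\<sigma> \<subseteq> {1..d} \<times> {1..d}" using \<sigma> by (rule equiv_type)
  have ij: "i \<in> {1..d}" "j \<in> {1..d}" using j sub by auto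
  have "f i \<noteq> i"
  proof
    assume fi: "f i = i"
    \<comment> \<open>\<open>h x\<close> says that \<open>x\<close> descends to \<open>i\<close>. If
      \<open>i\<close> were a root, this property would be constant on the class of
      \<open>i\<close>; but the ancestors of \<open>j\<close> stay at most
      \<open>j < i\<close>.\<close>
    define h where "h = (\<lambda>x. \<exists>n. (f ^^ n) x = i)"
    have "h (f x) = h x" for x
    proof
      assume "h (f x)"
      then obtain n where "(f ^^ n) (f x) = i" by (auto simp: h_def)
      then show "h x" unfolding h_def by (intro exI[of _ "Suc n"]) (simp add: funpow_swap1)
    next
      assume "h x"
      then obtain n where n: "(f ^^ n) x = i" by (auto simp: h_def)
      show "h (f x)"
      proof (cases n)
        case 0
        then show ?thesis using n fi unfolding h_def by (intro exI[of _ 0]) simp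
      next
        case (Suc m)
        then show ?thesis using n unfolding h_def by (intro exI[of _ m]) (simp add: funpow_swap1)
      qed
    qed
    then have "h j = h i"
      using j(2) unfolding conn[symmetric] by (elim connD) auto
    moreover have "h i" unfolding h_def by (intro exI[of _ 0]) simp
    moreover have "(f ^^ n) j \<in> {1..d} \<and> (f ^^ n) j \<le> j" for n
    proof (induction n)
      case (Suc n)
      then show ?case using parent_mapsD[OF f, of "(f ^^ n) j"] sub by auto
    qed (use ij in auto)
    then have "\<not> h j" unfolding h_def using j(1) by (metis leD)
    ultimately show False by simp
  qed
  then show "i \<in> {i \<in> {1..d}. f i \<noteq> i}" using ij by simp
qed

lemma parent_maps_spanning:
  assumes \<sigma>: "equiv {1..d} \<sigma>"
  shows "\<exists>f\<in>parent_maps d \<sigma>. conn {1..d} (parent_graph d f) = \<sigma>"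
proof -
  have sub: "\<sigma> \<subseteq> {1..d} \<times> {1..d}" using \<sigma> by (rule equiv_type)
  \<comment> \<open>Every vertex is attached directly to the minimum of its class.\<close>
  define f where "f = (\<lambda>i\<in>{1..d}. LEAST j. (j, i) \<in> \<sigma>)"
  have fi: "(f i, i) \<in> \<sigma>" "f i \<le> i" if "i \<in> {1..d}" for i
  proof -
    have "(i, i) \<in> \<sigma>" using \<sigma> that by (meson equivE refl_onD)
    then have "((LEAST j. (j, i) \<in> \<sigma>), i) \<in> \<sigma>" "(LEAST j. (j, i) \<in> \<sigma>) \<le> i"
      by (rule LeastI, rule Least_le)
    then show "(f i, i) \<in> \<sigma>" "f i \<le> i"
      using that by (simp_all add: f_def)
  qed
  then have "f \<in> parent_maps d \<sigma>" by (auto simp: parent_maps_def f_def)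
  moreover have "conn {1..d} (parent_graph d f) = \<sigma>"
  proof (intro equalityI subrelI)
    fix i j assume ij: "(i, j) \<in> conn {1..d} (parent_graph d f)"
    then have "i \<in> {1..d}" "j \<in> {1..d}" using conn_subset by fast+
    moreover have "\<sigma> `` {i} = \<sigma> `` {j}"
      using ij by (rule connD) (use fi \<sigma> in \<open>auto simp: equiv_class_eq_iff\<close>)
    ultimately show "(i, j) \<in> \<sigma>" using \<sigma> by (simp add: equiv_class_eq_iff)
  next
    fix i j assume ij: "(i, j) \<in> \<sigma>"
    have mem: "i \<in> {1..d}" "j \<in> {1..d}" using ij sub by auto
    have "(\<lambda>k. (k, i) \<in> \<sigma>) = (\<lambda>k. (k, j) \<in> \<sigma>)"
      using \<sigma> ij by (intro ext) (meson equivE symD transD)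
    then have eq: "f i = f j" using mem by (simp add: f_def)
    show "(i, j) \<in> conn {1..d} (parent_graph d f)"
    proof (rule connI)
      fix g :: "nat \<Rightarrow> bool"
      assume g: "\<And>a b. (a, b) \<in> parent_graph d f \<Longrightarrow> a \<in> {1..d} \<Longrightarrow> b \<in> {1..d} \<Longrightarrow> g a = g b"
      have "g (f k) = g k" if "k \<in> {1..d}" for k
        using that fi(1)[OF that] sub by (intro g) auto
      then show "g i = g j" using mem eq by metis
    qed (use mem in auto)
  qed
  ultimately show ?thesis by blast
qed

section \<open>Set partitions as equivalence relations, and the span of the elementary
  functions\<close>

definition same_block :: "nat set set \<Rightarrow> (nat \<times> nat) set" where
  "same_block \<pi> = {(i, j). \<exists>B\<in>\<pi>. i \<in> B \<and> j \<in> B}"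

lemma equiv_same_block: "partition_on A \<pi> \<Longrightarrow> equiv A (same_block \<pi>)"
  unfolding same_block_def by (rule equiv_partition_on)

lemma same_block_subset: "partition_on A \<pi> \<Longrightarrow> same_block \<pi> \<subseteq> A \<times> A"
  using equiv_same_block by (rule equiv_type)

lemma quotient_same_block: "partition_on A \<pi> \<Longrightarrow> A // same_block \<pi> = \<pi>"
  unfolding same_block_def by (rule partition_on_eq_quotient)

lemma same_block_quotient:
  assumes \<sigma>: "equiv A \<sigma>"
  shows "same_block (A // \<sigma>) = \<sigma>"
proof (intro equalityI subrelI)
  fix i j assume "(i, j) \<in> same_block (A // \<sigma>)"
  then obtain B where "B \<in> A // \<sigma>" "i \<in> B" "j \<in> B" by (auto simp: same_block_def)
  then show "(i, j) \<in> \<sigma>" using quotient_eq_iff[OF \<sigma>, of B B i j] by simp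
next
  fix i j assume ij: "(i, j) \<in> \<sigma>"
  then have "i \<in> A" using equiv_type[OF \<sigma>] by auto
  then have "\<sigma> `` {i} \<in> A // \<sigma>" "i \<in> \<sigma> `` {i}" "j \<in> \<sigma> `` {i}"
    using ij equiv_class_self[OF \<sigma>] by (auto intro: quotientI)
  then show "(i, j) \<in> same_block (A // \<sigma>)" by (auto simp: same_block_def)
qed

lemma block_eq:
  assumes "partition_on A \<pi>" "B \<in> \<pi>" "i \<in> B"
  shows "block \<pi> i = B"
  unfolding block_def using assms by (intro the_equality) (auto simp: partition_on_def disjoint_def)

lemma block_mem:
  assumes "partition_on A \<pi>" "i \<in> A"
  shows "block \<pi> i \<in> \<pi>" "i \<in> block \<pi> i"
proof -
  obtain B where "B \<in> \<pi>" "i \<in> B" using assms by (auto simp: partition_on_def)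
  then show "block \<pi> i \<in> \<pi>" "i \<in> block \<pi> i" using block_eq[OF assms(1)] by auto
qed

lemma block_eq_iff:
  assumes \<pi>: "partition_on A \<pi>" and "i \<in> A" "j \<in> A"
  shows "block \<pi> i = block \<pi> j \<longleftrightarrow> (i, j) \<in> same_block \<pi>"
proof
  assume "block \<pi> i = block \<pi> j"
  then show "(i, j) \<in> same_block \<pi>"
    using block_mem[OF \<pi> assms(2)] block_mem[OF \<pi> assms(3)] by (auto simp: same_block_def)
next
  assume "(i, j) \<in> same_block \<pi>"
  then obtain B where "B \<in> \<pi>" "i \<in> B" "j \<in> B" by (auto simp: same_block_def)
  then show "block \<pi> i = block \<pi> j" using block_eq[OF \<pi>] by simp
qed

lemma nc_e_eq_monomial_sum:
  assumes \<pi>: "partition_on {1..d} \<pi>"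
  shows "nc_e d \<pi> = nc_monomial_sum d {\<kappa> \<in> {1..d} \<rightarrow>\<^sub>E {0<..}. \<forall>(i, j) \<in> same_block \<pi> - Id. \<kappa> i \<noteq> \<kappa> j}"
proof -
  have "(\<forall>j\<in>{1..d}. \<forall>k\<in>{1..d}. j \<noteq> k \<and> block \<pi> j = block \<pi> k \<longrightarrow> \<kappa> j \<noteq> \<kappa> k)
      \<longleftrightarrow> (\<forall>(i, j) \<in> same_block \<pi> - Id. \<kappa> i \<noteq> \<kappa> j)" (is "?l = ?r") for \<kappa> :: "nat \<Rightarrow> nat"
  proof
    assume l: ?l
    show ?r
    proof
      fix x assume x: "x \<in> same_block \<pi> - Id"
      obtain i j where ij: "x = (i, j)" "i \<noteq> j" "(i, j) \<in> same_block \<pi>" using x by (cases x) auto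
      then have "i \<in> {1..d}" "j \<in> {1..d}" using same_block_subset[OF \<pi>] by auto
      then show "case x of (i, j) \<Rightarrow> \<kappa> i \<noteq> \<kappa> j" using l ij block_eq_iff[OF \<pi>, of i j] by auto
    qed
  next
    assume r: ?r
    show ?l
    proof (intro ballI impI notI)
      fix i j assume ij: "i \<in> {1..d}" "j \<in> {1..d}" "i \<noteq> j \<and> block \<pi> i = block \<pi> j" "\<kappa> i = \<kappa> j"
      then have "(i, j) \<in> same_block \<pi> - Id" using block_eq_iff[OF \<pi>, of i j] by simp
      then show False using r ij(4) by auto
    qed
  qed
  then show ?thesis by (simp only: nc_e_def)
qed

lemma nc_e_eq_kernel_series:
  assumes \<pi>: "partition_on {1..d} \<pi>"
  shows "nc_e d \<pi> = kernel_series d {} (same_block \<pi> - Id)"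
  unfolding nc_e_eq_monomial_sum[OF \<pi>]
  using same_block_subset[OF \<pi>] by (intro nc_monomial_sum_eq_kernel_series) auto

definition set_partitions :: "nat \<Rightarrow> nat set set set" where
  "set_partitions d = {\<pi>. partition_on {1..d} \<pi>}"

lemma finite_set_partitions: "finite (set_partitions d)"
  unfolding set_partitions_def by (intro finitely_many_partition_on finite_atLeastAtMost)

text \<open>Triangularity, by induction on the size of the generated relation
  \<open>\<sigma>\<close>. In the forest expansion of the elementary function of
  \<open>\<sigma>\<close>, the forests in \<open>F1\<close> all contribute the wanted series with
  the same sign, so its coefficient is nonzero and can be divided out. Every other forest generates
  a smaller relation.\<close>

lemma kernel_series_in_span_nc_e:
  assumes "R \<subseteq> {1..d} \<times> {1..d}"
  shows "kernel_series d R {} \<in> nc.span (nc_e d ` set_partitions d)" (is "_ \<in> nc.span ?E")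
  using assms
proof (induction "card (conn {1..d} R)" arbitrary: R rule: less_induct)
  case less
  define \<sigma> where "\<sigma> = conn {1..d} R"
  have \<sigma>: "equiv {1..d} \<sigma>" unfolding \<sigma>_def by (rule equiv_conn)
  then have sub: "\<sigma> \<subseteq> {1..d} \<times> {1..d}" by (rule equiv_type)
  then have fin: "finite \<sigma>" using finite_subset by auto
  let ?F = "parent_maps d \<sigma>" and ?m = "card {i. \<exists>j<i. (j, i) \<in> \<sigma>}"
  let ?p = "\<lambda>f. nc_scale ((-1) ^ card {i \<in> {1..d}. f i \<noteq> i}) (kernel_series d (parent_graph d f) {})"
  define F1 where "F1 = {f \<in> ?F. conn {1..d} (parent_graph d f) = \<sigma>}"
  have graph: "parent_graph d f \<subseteq> {1..d} \<times> {1..d}" if "f \<in> ?F" for f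
    using subsetD[OF sub parent_mapsD(1)[OF that]] by auto
  have rest: "?p f \<in> nc.span ?E" if f: "f \<in> ?F - F1" for f
  proof -
    have "parent_graph d f \<inter> {1..d} \<times> {1..d} \<subseteq> conn {1..d} R"
      using f parent_mapsD(1)[of f d \<sigma>] unfolding \<sigma>_def by auto
    then have "conn {1..d} (parent_graph d f) \<subseteq> \<sigma>"
      unfolding \<sigma>_def by (rule conn_mono)
    then have "conn {1..d} (parent_graph d f) \<subset> \<sigma>" using f by (auto simp: F1_def)
    then have "card (conn {1..d} (parent_graph d f)) < card (conn {1..d} R)"
      using psubset_card_mono[OF fin] by (simp add: \<sigma>_def)
    then show ?thesis using less.hyps graph f by (intro nc.span_scale) auto
  qed
  have lead: "?p f = nc_scale ((-1) ^ ?m) (kernel_series d R {})" if f: "f \<in> F1" for f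
  proof -
    have "f \<in> ?F" "conn {1..d} (parent_graph d f) = \<sigma>" using f by (auto simp: F1_def)
    then show ?thesis
      using parent_maps_nonroots[OF \<sigma>, of f] kernel_series_conn[OF graph, of f]
        kernel_series_conn[OF less.prems] by (simp add: \<sigma>_def)
  qed
  have "F1 \<subseteq> ?F" by (auto simp: F1_def)
  have "nc_e d ({1..d} // \<sigma>) = kernel_series d {} (\<sigma> - Id)"
    using nc_e_eq_kernel_series[OF partition_on_quotient[OF \<sigma>]] same_block_quotient[OF \<sigma>] by simp
  also have "\<dots> = (\<Sum>f\<in>?F - F1. ?p f) + (\<Sum>f\<in>F1. ?p f)"
    unfolding kernel_series_expand[OF \<sigma>] using \<open>F1 \<subseteq> ?F\<close> finite_parent_maps
    by (rule sum.subset_diff)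
  also have "(\<Sum>f\<in>F1. ?p f) = nc_scale (of_nat (card F1) * (-1) ^ ?m) (kernel_series d R {})"
    using lead by (simp add: fun_eq_iff sum_nc_apply nc_scale_def)
  finally have eq: "nc_scale (of_nat (card F1) * (-1) ^ ?m) (kernel_series d R {})
      = nc_e d ({1..d} // \<sigma>) - (\<Sum>f\<in>?F - F1. ?p f)"
    by (simp only: add_diff_cancel_left')
  have "nc_e d ({1..d} // \<sigma>) \<in> nc.span ?E"
    using partition_on_quotient[OF \<sigma>] by (intro nc.span_base) (simp add: set_partitions_def)
  then have "nc_scale (of_nat (card F1) * (-1) ^ ?m) (kernel_series d R {}) \<in> nc.span ?E"
    unfolding eq using rest by (intro nc.span_diff nc.span_sum) auto
  then have "nc_scale (inverse (of_nat (card F1) * (-1) ^ ?m))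
      (nc_scale (of_nat (card F1) * (-1) ^ ?m) (kernel_series d R {})) \<in> nc.span ?E"
    by (rule nc.span_scale)
  moreover have "F1 \<noteq> {}" using parent_maps_spanning[OF \<sigma>] by (auto simp: F1_def)
  then have "(of_nat (card F1) * (-1) ^ ?m :: rat) \<noteq> 0"
    using finite_subset[OF \<open>F1 \<subseteq> ?F\<close> finite_parent_maps] by simp
  ultimately show ?case by (simp only: nc.scale_scale left_inverse nc.scale_one not_False_eq_True)
qed

text \<open>Covers both the chromatic series, where \<open>R = {}\<close>, and the monomial
  functions \<open>nc_m\<close>.\<close>

lemma kernel_series_in_span_nc_e':
  assumes "R \<subseteq> {1..d} \<times> {1..d}" "D \<subseteq> {1..d} \<times> {1..d}"
  shows "kernel_series d R D \<in> nc.span (nc_e d ` set_partitions d)"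
proof -
  have "kernel_series d R D \<in> nc.span ((\<lambda>R. kernel_series d R {}) ` Pow ({1..d} \<times> {1..d}))"
    using assms finite_subset[OF assms(2)] by (intro kernel_series_in_span) auto
  moreover have "nc.span ((\<lambda>R. kernel_series d R {}) ` Pow ({1..d} \<times> {1..d}))
      \<subseteq> nc.span (nc_e d ` set_partitions d)"
    using kernel_series_in_span_nc_e by (intro nc.span_minimal nc.subspace_span) blast
  ultimately show ?thesis by blast
qed

section \<open>Monomial functions and linear independence of the elementary ones\<close>

definition nc_m :: "nat \<Rightarrow> nat set set \<Rightarrow> nc_series" where
  "nc_m d \<pi> = kernel_series d (same_block \<pi>) ({1..d} \<times> {1..d} - same_block \<pi>)"

definition nc_word :: "nat \<Rightarrow> nat set set \<Rightarrow> nat list" where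
  "nc_word d \<pi> = map (\<lambda>i. Min (block \<pi> i)) [1..<Suc d]"

text \<open>In \<open>nc_word d \<pi>\<close> each position carries the minimum of its block, so
  letters coincide exactly within blocks. Evaluation at these words is thus dual to the family
  \<open>nc_m\<close>.\<close>

lemma nc_m_word:
  assumes \<pi>: "partition_on {1..d} \<pi>" and \<rho>: "partition_on {1..d} \<rho>"
  shows "nc_m d \<rho> (nc_word d \<pi>) = of_bool (\<rho> = \<pi>)"
proof -
  have fin: "finite (block \<pi> i)" "block \<pi> i \<noteq> {}" "block \<pi> i \<subseteq> {1..d}" if "i \<in> {1..d}" for i
  proof -
    show "block \<pi> i \<subseteq> {1..d}" using block_mem(1)[OF \<pi> that] \<pi> by (auto simp: partition_on_def)
    then show "finite (block \<pi> i)" using finite_subset by auto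
    show "block \<pi> i \<noteq> {}" using block_mem(2)[OF \<pi> that] by auto
  qed
  have letter: "letter (nc_word d \<pi>) i = Min (block \<pi> i)" if "i \<in> {1..d}" for i
    unfolding nc_word_def using that by (rule letter_map)
  have iff: "letter (nc_word d \<pi>) i = letter (nc_word d \<pi>) j \<longleftrightarrow> (i, j) \<in> same_block \<pi>"
    if "i \<in> {1..d}" "j \<in> {1..d}" for i j
  proof
    assume "letter (nc_word d \<pi>) i = letter (nc_word d \<pi>) j"
    then have "Min (block \<pi> i) \<in> block \<pi> i" "Min (block \<pi> i) \<in> block \<pi> j"
      using that fin Min_in by (metis letter)+
    then have "block \<pi> i = block \<pi> j"
      using block_eq[OF \<pi>] block_mem(1)[OF \<pi>] that by metis
    then show "(i, j) \<in> same_block \<pi>" using block_eq_iff[OF \<pi>] that by simp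
  next
    assume "(i, j) \<in> same_block \<pi>"
    then show "letter (nc_word d \<pi>) i = letter (nc_word d \<pi>) j"
      using block_eq_iff[OF \<pi> that] that by (simp add: letter)
  qed
  have "Min (block \<pi> i) \<in> {0<..}" if "i \<in> {1..d}" for i
    using Min_in[of "block \<pi> i"] fin[OF that] by auto
  then have word: "nc_word d \<pi> \<in> nc_words d"
    unfolding nc_word_def by (intro map_in_nc_words) auto
  have "(\<forall>(i, j) \<in> same_block \<rho>. letter (nc_word d \<pi>) i = letter (nc_word d \<pi>) j)
      \<longleftrightarrow> same_block \<rho> \<subseteq> same_block \<pi>"
    using same_block_subset[OF \<rho>] iff by blast
  moreover have "(\<forall>(i, j) \<in> {1..d} \<times> {1..d} - same_block \<rho>. letter (nc_word d \<pi>) i \<noteq> letter (nc_word d \<pi>) j)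
      \<longleftrightarrow> same_block \<pi> \<subseteq> same_block \<rho>"
    using same_block_subset[OF \<pi>] iff by blast
  ultimately have "nc_m d \<rho> (nc_word d \<pi>) = of_bool (same_block \<rho> = same_block \<pi>)"
    unfolding nc_m_def kernel_series_def using word by auto
  also have "same_block \<rho> = same_block \<pi> \<longleftrightarrow> \<rho> = \<pi>"
    using quotient_same_block[OF \<pi>] quotient_same_block[OF \<rho>] by metis
  finally show ?thesis .
qed

lemma inj_on_nc_m: "inj_on (nc_m d) (set_partitions d)"
proof (rule inj_onI)
  fix \<pi> \<rho> assume "\<pi> \<in> set_partitions d" "\<rho> \<in> set_partitions d" "nc_m d \<pi> = nc_m d \<rho>"
  then show "\<pi> = \<rho>"
    using nc_m_word[of d \<pi> \<rho>] nc_m_word[of d \<pi> \<pi>] by (auto simp: set_partitions_def split: if_splits)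
qed

lemma independent_nc_m: "nc.independent (nc_m d ` set_partitions d)"
proof
  let ?P = "set_partitions d"
  assume "nc.dependent (nc_m d ` ?P)"
  then obtain u where u: "\<exists>f\<in>nc_m d ` ?P. u f \<noteq> 0" "(\<Sum>f\<in>nc_m d ` ?P. nc_scale (u f) f) = 0"
    using nc.dependent_finite[OF finite_imageI[OF finite_set_partitions]] by blast
  then obtain \<pi> where \<pi>: "partition_on {1..d} \<pi>" "u (nc_m d \<pi>) \<noteq> 0" by (auto simp: set_partitions_def)
  have "0 = (\<Sum>\<rho>\<in>?P. nc_scale (u (nc_m d \<rho>)) (nc_m d \<rho>)) (nc_word d \<pi>)"
    using u(2) by (simp add: sum.reindex[OF inj_on_nc_m])
  also have "\<dots> = (\<Sum>\<rho>\<in>?P. u (nc_m d \<rho>) * of_bool (\<rho> = \<pi>))"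
    unfolding sum_nc_apply using nc_m_word[OF \<pi>(1)] by (intro sum.cong) (auto simp: nc_scale_def set_partitions_def)
  also have "\<dots> = u (nc_m d \<pi>)"
    using finite_set_partitions \<pi>(1) by (subst sum.remove[of _ \<pi>]) (auto simp: set_partitions_def)
  finally show False using \<pi>(2) by simp
qed

text \<open>The \<open>e\<^sub>\<pi>\<close> span the equally many linearly independent \<open>m\<^sub>\<pi>\<close>.\<close>

lemma
  shows inj_on_nc_e: "inj_on (nc_e d) (set_partitions d)"
    and independent_nc_e: "nc.independent (nc_e d ` set_partitions d)"
proof -
  let ?P = "set_partitions d"
  \<comment> \<open>The bound on independent sets in the span of \<open>B\<close> gives
    \<open>card ?P \<le> card B\<close>. The chain through the image back to \<open>card ?P\<close>
    then collapses, which yields injectivity and \<open>B = nc_e d\<close> followed by the whole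
    image of \<open>?P\<close> at once.\<close>
  obtain B where B: "B \<subseteq> nc_e d ` ?P" "nc.independent B" "nc_e d ` ?P \<subseteq> nc.span B"
    by (rule nc.maximal_independent_subset)
  have finB: "finite B" using B(1) finite_set_partitions finite_subset by blast
  have "nc_m d ` ?P \<subseteq> nc.span (nc_e d ` ?P)"
  proof (rule image_subsetI)
    fix \<pi> assume "\<pi> \<in> set_partitions d"
    then have "same_block \<pi> \<subseteq> {1..d} \<times> {1..d}"
      using same_block_subset by (simp add: set_partitions_def)
    then show "nc_m d \<pi> \<in> nc.span (nc_e d ` ?P)"
      unfolding nc_m_def by (rule kernel_series_in_span_nc_e') blast
  qed
  also have "\<dots> \<subseteq> nc.span B"
    using B(3) by (rule nc.span_minimal) (rule nc.subspace_span)
  finally have "card (nc_m d ` ?P) \<le> card B"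
    using nc.independent_span_bound[OF finB independent_nc_m] by blast
  then have "card ?P \<le> card B" by (simp add: card_image inj_on_nc_m)
  moreover have "card B \<le> card (nc_e d ` ?P)"
    using B(1) finite_set_partitions by (intro card_mono) auto
  moreover have "card (nc_e d ` ?P) \<le> card ?P"
    using finite_set_partitions by (rule card_image_le)
  ultimately have card: "card (nc_e d ` ?P) = card ?P" "card B = card (nc_e d ` ?P)" by linarith+
  show "inj_on (nc_e d) ?P" using finite_set_partitions card(1) by (rule eq_card_imp_inj_on)
  have "B = nc_e d ` ?P" using B(1) card(2) finite_set_partitions by (intro card_subset_eq) auto
  then show "nc.independent (nc_e d ` ?P)" using B(2) by simp
qed

lemma kernel_series_eq_sum_nc_e:
  assumes "E \<subseteq> {1..d} \<times> {1..d}"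
  shows "kernel_series d {} E = (\<Sum>\<pi>\<in>set_partitions d.
    nc_scale (nc.representation (nc_e d ` set_partitions d) (kernel_series d {} E) (nc_e d \<pi>)) (nc_e d \<pi>))"
proof -
  let ?B = "nc_e d ` set_partitions d"
  have "(\<Sum>b\<in>?B. nc_scale (nc.representation ?B (kernel_series d {} E) b) b) = kernel_series d {} E"
    using independent_nc_e kernel_series_in_span_nc_e'[of "{}" d E] assms finite_set_partitions
    by (intro nc.sum_representation_eq) auto
  then show ?thesis by (simp add: sum.reindex[OF inj_on_nc_e])
qed

section \<open>From coefficients to chromatic polynomials\<close>

text \<open>In a sum over these words only the vertices in \<open>S\<close> are coloured freely; every other vertex has a
  private colour.\<close>

definition marked_words :: "nat \<Rightarrow> nat set \<Rightarrow> nat \<Rightarrow> nat list set" where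
  "marked_words d S q = {w. length w = d \<and> (\<forall>i\<in>{1..d}. if i \<in> S then letter w i \<in> {1..q} else letter w i = q + i)}"

lemma marked_wordsD:
  assumes "w \<in> marked_words d S q" "i \<in> {1..d}"
  shows "if i \<in> S then letter w i \<in> {1..q} else letter w i = q + i"
  using assms unfolding marked_words_def by blast

lemma marked_words_subset: "marked_words d S q \<subseteq> nc_words d"
proof
  fix w assume w: "w \<in> marked_words d S q"
  have "w ! k \<noteq> 0" if "k < d" for k
  proof -
    have "Suc k \<in> {1..d}" using that by simp
    then have "letter w (Suc k) \<noteq> 0"
      using marked_wordsD[OF w, of "Suc k"] by (cases "Suc k \<in> S") simp_all
    then show ?thesis by (simp add: letter_def)
  qed
  then show "w \<in> nc_words d"
    using w by (auto simp: nc_words_def marked_words_def in_set_conv_nth)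
qed

text \<open>The private letters \<open>q + i\<close> are larger than \<open>q\<close> and pairwise
  different, so an edge with an end outside \<open>S\<close> is never violated. Summing over these
  words is linear in the series; it counts colourings of the graph induced on
  \<open>S\<close>.\<close>

lemma sum_kernel_series_marked_words:
  assumes S: "S \<subseteq> {1..d}" and E: "E \<subseteq> {1..d} \<times> {1..d}" and loop: "\<And>i. (i, i) \<notin> E"
  shows "finite (marked_words d S q)"
    and "(\<Sum>w\<in>marked_words d S q. kernel_series d {} E w) = of_nat (card (cols S E q))"
proof -
  define ext where "ext = (\<lambda>(\<kappa> :: nat \<Rightarrow> nat) i. if i \<in> S then \<kappa> i else q + i)"
  have le: "letter w i \<le> q + d" if "w \<in> marked_words d S q" "i \<in> {1..d}" for w i
    using marked_wordsD[OF that] that(2) by (cases "i \<in> S") simp_all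
  have "marked_words d S q \<subseteq> {w. set w \<subseteq> {..q + d} \<and> length w = d}"
  proof
    fix w assume w: "w \<in> marked_words d S q"
    then have len: "length w = d" by (simp add: marked_words_def)
    have "w ! k \<le> q + d" if "k < d" for k
      using le[OF w, of "Suc k"] that by (simp add: letter_def)
    then show "w \<in> {w. set w \<subseteq> {..q + d} \<and> length w = d}"
      using len by (auto simp: in_set_conv_nth)
  qed
  moreover have "finite {w. set w \<subseteq> {..q + d} \<and> length w = d}"
    by (intro finite_lists_length_eq) simp
  ultimately show fin: "finite (marked_words d S q)" by (rule finite_subset)
  let ?W = "{w \<in> marked_words d S q. \<forall>(i, j) \<in> E. letter w i \<noteq> letter w j}"
  have ext_letter: "letter (map (ext \<kappa>) [1..<Suc d]) i = ext \<kappa> i" if "i \<in> {1..d}" for \<kappa> i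
    using that by (rule letter_map)
  have "bij_betw (\<lambda>\<kappa>. map (ext \<kappa>) [1..<Suc d]) (cols S E q) ?W"
  proof (rule bij_betw_byWitness[where f' = "\<lambda>w. restrict (letter w) S"])
    show "\<forall>\<kappa>\<in>cols S E q. restrict (letter (map (ext \<kappa>) [1..<Suc d])) S = \<kappa>"
    proof
      fix \<kappa> assume \<kappa>: "\<kappa> \<in> cols S E q"
      show "restrict (letter (map (ext \<kappa>) [1..<Suc d])) S = \<kappa>"
      proof
        fix i
        show "restrict (letter (map (ext \<kappa>) [1..<Suc d])) S i = \<kappa> i"
          using ext_letter[of i \<kappa>] S PiE_arb[OF colsD(1)[OF \<kappa>], of i]
          by (cases "i \<in> S") (auto simp: ext_def simp del: upt_Suc)
      qed
    qed
    show "\<forall>w\<in>?W. map (ext (restrict (letter w) S)) [1..<Suc d] = w"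
    proof
      fix w assume "w \<in> ?W"
      then have w: "w \<in> marked_words d S q" by simp
      have "map (ext (restrict (letter w) S)) [1..<Suc d] = map (letter w) [1..<Suc d]"
      proof (rule map_cong)
        fix i assume "i \<in> set [1..<Suc d]"
        then have "i \<in> {1..d}" by auto
        then show "ext (restrict (letter w) S) i = letter w i"
          using marked_wordsD[OF w, of i] by (simp add: ext_def split: if_splits)
      qed simp
      then show "map (ext (restrict (letter w) S)) [1..<Suc d] = w"
        using w map_letter[of w d] by (simp only: marked_words_def mem_Collect_eq)
    qed
    show "(\<lambda>\<kappa>. map (ext \<kappa>) [1..<Suc d]) ` cols S E q \<subseteq> ?W"
    proof (rule image_subsetI)
      fix \<kappa> assume \<kappa>: "\<kappa> \<in> cols S E q"
      have range: "\<kappa> i \<in> {1..q}" if "i \<in> S" for i using colsD(1)[OF \<kappa>] that by (rule PiE_mem)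
      have "ext \<kappa> i \<noteq> ext \<kappa> j" if ij: "(i, j) \<in> E" for i j
      proof -
        have "i \<in> {1..d}" "j \<in> {1..d}" "i \<noteq> j" using ij E loop by auto
        then show ?thesis
          using range[of i] range[of j] colsD(2)[OF \<kappa> ij] unfolding ext_def by auto
      qed
      then have "\<forall>(i, j) \<in> E. letter (map (ext \<kappa>) [1..<Suc d]) i \<noteq> letter (map (ext \<kappa>) [1..<Suc d]) j"
        using E ext_letter by fastforce
      moreover have "map (ext \<kappa>) [1..<Suc d] \<in> marked_words d S q"
        unfolding marked_words_def mem_Collect_eq
      proof (intro conjI ballI)
        fix i assume i: "i \<in> {1..d}"
        show "if i \<in> S then letter (map (ext \<kappa>) [1..<Suc d]) i \<in> {1..q}
          else letter (map (ext \<kappa>) [1..<Suc d]) i = q + i"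
          unfolding ext_letter[OF i] using range[of i] by (simp add: ext_def)
      qed simp
      ultimately show "map (ext \<kappa>) [1..<Suc d] \<in> ?W" by blast
    qed
    show "(\<lambda>w. restrict (letter w) S) ` ?W \<subseteq> cols S E q"
    proof (rule image_subsetI)
      fix w assume w: "w \<in> ?W"
      show "restrict (letter w) S \<in> cols S E q"
      proof (rule colsI)
        show "restrict (letter w) S \<in> S \<rightarrow>\<^sub>E {1..q}"
        proof (subst restrict_PiE_iff, rule ballI)
          fix i assume "i \<in> S"
          then show "letter w i \<in> {1..q}" using marked_wordsD[of w d S q i] w S by auto
        qed
        fix i j assume "(i, j) \<in> E" "i \<in> S" "j \<in> S"
        then show "restrict (letter w) S i \<noteq> restrict (letter w) S j" using w by auto
      qed
    qed
  qed
  then have card: "card (cols S E q) = card ?W" by (rule bij_betw_same_card)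
  have "(\<Sum>w\<in>marked_words d S q. kernel_series d {} E w)
      = (\<Sum>w\<in>marked_words d S q. of_bool (\<forall>(i, j) \<in> E. letter w i \<noteq> letter w j))"
    using marked_words_subset by (intro sum.cong) (auto simp: kernel_series_def)
  also have "\<dots> = of_nat (card ?W)"
    using fin by (simp add: of_bool_def sum.If_cases Int_def)
  finally show "(\<Sum>w\<in>marked_words d S q. kernel_series d {} E w) = of_nat (card (cols S E q))"
    using card by simp
qed

text \<open>The graph is a disjoint union of cliques. When \<open>v\<close> is coloured last, the
  vertices of its block in \<open>S\<close> already occupy pairwise different colours, which
  contributes the next factor of a falling factorial.\<close>

lemma card_cols_same_block:
  assumes \<pi>: "partition_on A \<pi>" and "finite A" "S \<subseteq> A"
  shows "(of_nat (card (cols S (same_block \<pi> - Id) q)) :: rat)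
    = (\<Prod>B\<in>\<pi>. \<Prod>k<card (B \<inter> S). of_nat q - of_nat k)"
proof -
  have fin\<pi>: "finite \<pi>" using finite_elements[OF \<open>finite A\<close> \<pi>] .
  have "finite S" using assms finite_subset by auto
  then show ?thesis using \<open>S \<subseteq> A\<close>
  proof (induction S rule: finite_induct)
    case empty
    have "cols {} (same_block \<pi> - Id) q = {\<lambda>_. undefined}" by (auto simp: cols_def)
    then show ?case by simp
  next
    case (insert v S)
    let ?E = "same_block \<pi> - Id" and ?b = "block \<pi> v"
    have v: "v \<in> A" "S \<subseteq> A" using insert.prems by auto
    have b: "?b \<in> \<pi>" "v \<in> ?b" using block_mem[OF \<pi> v(1)] by auto
    have other: "v \<notin> B" if "B \<in> \<pi> - {?b}" for B
      using block_eq[OF \<pi>, of B v] that by auto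
    have same: "(u, v) \<in> same_block \<pi> \<longleftrightarrow> u \<in> ?b" "(v, u) \<in> same_block \<pi> \<longleftrightarrow> u \<in> ?b" for u
    proof -
      have "B = ?b" if "B \<in> \<pi>" "v \<in> B" for B using block_eq[OF \<pi> that] by simp
      then show "(u, v) \<in> same_block \<pi> \<longleftrightarrow> u \<in> ?b" "(v, u) \<in> same_block \<pi> \<longleftrightarrow> u \<in> ?b"
        using b unfolding same_block_def by blast+
    qed
    have N: "?b \<inter> S = {u \<in> S. (u, v) \<in> ?E \<or> (v, u) \<in> ?E}"
      using insert.hyps(2) same by auto
    have inj: "card (\<kappa> ` (?b \<inter> S)) = card (?b \<inter> S)" if "\<kappa> \<in> cols S ?E q" for \<kappa>
    proof (rule card_image, rule inj_onI, rule ccontr)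
      fix i j assume "i \<in> ?b \<inter> S" "j \<in> ?b \<inter> S" "\<kappa> i = \<kappa> j" "i \<noteq> j"
      moreover from this have "(i, j) \<in> ?E" using b(1) by (auto simp: same_block_def)
      ultimately show False using colsD(2)[OF that, of i j] by auto
    qed
    have "(of_int (int (card (cols (insert v S) ?E q))) :: rat)
        = of_int (\<Sum>\<kappa>\<in>cols S ?E q. int q - int (card (\<kappa> ` (?b \<inter> S))))"
      using insert.hyps by (subst card_cols_insert[OF _ _ _ N]) auto
    also have "\<dots> = of_int (\<Sum>\<kappa>\<in>cols S ?E q. int q - int (card (?b \<inter> S)))"
      using inj by simp
    also have "\<dots> = of_nat (card (cols S ?E q)) * (of_nat q - of_nat (card (?b \<inter> S)))"
      by simp
    also have "of_nat (card (cols S ?E q)) = (\<Prod>B\<in>\<pi>. \<Prod>k<card (B \<inter> S). of_nat q - of_nat k :: rat)"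
      using insert.IH v(2) .
    also have "\<dots> = (\<Prod>k<card (?b \<inter> S). of_nat q - of_nat k)
        * (\<Prod>B\<in>\<pi> - {?b}. \<Prod>k<card (B \<inter> S). of_nat q - of_nat k)"
      using fin\<pi> b(1) by (rule prod.remove)
    finally have "of_nat (card (cols (insert v S) ?E q))
        = (\<Prod>k<Suc (card (?b \<inter> S)). of_nat q - of_nat k)
        * (\<Prod>B\<in>\<pi> - {?b}. \<Prod>k<card (B \<inter> S). of_nat q - of_nat k :: rat)"
      by (simp add: mult_ac)
    also have "Suc (card (?b \<inter> S)) = card (?b \<inter> insert v S)"
      using b(2) insert.hyps by simp
    also have "(\<Prod>B\<in>\<pi> - {?b}. \<Prod>k<card (B \<inter> S). of_nat q - of_nat k :: rat)
        = (\<Prod>B\<in>\<pi> - {?b}. \<Prod>k<card (B \<inter> insert v S). of_nat q - of_nat k)"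
      using other by (intro prod.cong) (auto simp: Int_insert_right)
    finally show ?case using prod.remove[OF fin\<pi> b(1), of "\<lambda>B. \<Prod>k<card (B \<inter> insert v S). of_nat q - of_nat k :: rat"]
      by simp
  qed
qed

lemma card_eq_sum_blocks:
  assumes \<pi>: "partition_on A \<pi>" and "finite A" "S \<subseteq> A"
  shows "card S = (\<Sum>B\<in>\<pi>. card (B \<inter> S))"
proof -
  have "S = (\<Union>B\<in>\<pi>. B \<inter> S)" using \<pi> assms(3) by (auto simp: partition_on_def)
  then have "card S = card (\<Union>B\<in>\<pi>. B \<inter> S)" by simp
  also have "\<dots> = (\<Sum>B\<in>\<pi>. card (B \<inter> S))"
  proof (rule card_UN_disjoint)
    show "finite \<pi>" using finite_elements[OF \<open>finite A\<close> \<pi>] .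
    show "\<forall>B\<in>\<pi>. finite (B \<inter> S)" using assms finite_subset by blast
    show "\<forall>B\<in>\<pi>. \<forall>C\<in>\<pi>. B \<noteq> C \<longrightarrow> B \<inter> S \<inter> (C \<inter> S) = {}"
      using \<pi> by (auto simp: partition_on_def disjoint_def)
  qed
  finally show ?thesis .
qed

section \<open>Falling factorials and evaluation at negative arguments\<close>

definition falling_poly :: "nat \<Rightarrow> rat poly" where
  "falling_poly n = (\<Prod>k<n. [:- of_nat k, 1:])"

lemma poly_falling_poly: "poly (falling_poly n) x = (\<Prod>k<n. x - of_nat k)"
  by (simp add: falling_poly_def poly_prod)

lemma poly_falling_poly_uminus: "poly (falling_poly n) (- x) = (-1) ^ n * pochhammer x n"
  by (induction n) (simp_all add: poly_falling_poly pochhammer_Suc algebra_simps)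

text \<open>Summing the expansion \<open>a\<close> over marked words gives an identity at every
  natural \<open>q\<close>, hence one of polynomials, which may be evaluated at \<open>- x\<close>.
  Each block then contributes a sign by its size within \<open>S\<close>; together these cancel
  against \<open>(-1) ^ card S\<close>.\<close>

lemma reciprocal_chromatic_expansion:
  fixes p :: "rat poly"
  assumes S: "S \<subseteq> {1..d}" and E: "E \<subseteq> {1..d} \<times> {1..d}" and loop: "\<And>i. (i, i) \<notin> E"
    and p: "\<And>q. poly p (of_nat q) = of_nat (card (cols S E q))"
    and a: "kernel_series d {} E = (\<Sum>\<pi>\<in>set_partitions d. nc_scale (a \<pi>) (nc_e d \<pi>))"
  shows "(-1) ^ card S * poly p (- x)
    = (\<Sum>\<pi>\<in>set_partitions d. a \<pi> * (\<Prod>B\<in>\<pi>. pochhammer x (card (B \<inter> S))))"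
proof -
  have \<pi>_sum: "(\<Sum>w\<in>marked_words d S q. nc_e d \<pi> w) = (\<Prod>B\<in>\<pi>. \<Prod>k<card (B \<inter> S). of_nat q - of_nat k)"
    if "\<pi> \<in> set_partitions d" for \<pi> q
  proof -
    have \<pi>: "partition_on {1..d} \<pi>" using that by (simp add: set_partitions_def)
    have "same_block \<pi> - Id \<subseteq> {1..d} \<times> {1..d}" using same_block_subset[OF \<pi>] by blast
    then show ?thesis
      using sum_kernel_series_marked_words(2)[OF S, of "same_block \<pi> - Id" q]
        card_cols_same_block[OF \<pi> _ S] by (simp add: nc_e_eq_kernel_series[OF \<pi>])
  qed
  have "p = (\<Sum>\<pi>\<in>set_partitions d. smult (a \<pi>) (\<Prod>B\<in>\<pi>. falling_poly (card (B \<inter> S))))"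
  proof (rule poly_eq_if_eq_on_nat)
    fix q
    have "poly p (of_nat q) = (\<Sum>w\<in>marked_words d S q. kernel_series d {} E w)"
      unfolding p by (rule sum_kernel_series_marked_words(2)[OF S E loop, symmetric])
    also have "\<dots> = (\<Sum>\<pi>\<in>set_partitions d. a \<pi> * (\<Sum>w\<in>marked_words d S q. nc_e d \<pi> w))"
      unfolding a sum_nc_apply nc_scale_def sum_distrib_left by (rule sum.swap)
    also have "\<dots> = (\<Sum>\<pi>\<in>set_partitions d. a \<pi> * (\<Prod>B\<in>\<pi>. \<Prod>k<card (B \<inter> S). of_nat q - of_nat k))"
      using \<pi>_sum by simp
    finally show "poly p (of_nat q)
        = poly (\<Sum>\<pi>\<in>set_partitions d. smult (a \<pi>) (\<Prod>B\<in>\<pi>. falling_poly (card (B \<inter> S)))) (of_nat q)"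
      by (simp add: poly_sum poly_prod poly_falling_poly)
  qed
  then have "(-1) ^ card S * poly p (- x)
      = (\<Sum>\<pi>\<in>set_partitions d. a \<pi> * ((-1) ^ card S * (\<Prod>B\<in>\<pi>. (-1) ^ card (B \<inter> S) * pochhammer x (card (B \<inter> S)))))"
    by (simp add: poly_sum poly_prod poly_falling_poly_uminus sum_distrib_left mult_ac)
  also have "\<dots> = (\<Sum>\<pi>\<in>set_partitions d. a \<pi> * (\<Prod>B\<in>\<pi>. pochhammer x (card (B \<inter> S))))"
  proof (rule sum.cong)
    fix \<pi> assume "\<pi> \<in> set_partitions d"
    then have "card S = (\<Sum>B\<in>\<pi>. card (B \<inter> S))"
      using S by (intro card_eq_sum_blocks) (auto simp: set_partitions_def)
    then have "(\<Prod>B\<in>\<pi>. (-1) ^ card (B \<inter> S) :: rat) = (-1) ^ card S"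
      by (simp add: power_sum)
    then show "a \<pi> * ((-1) ^ card S * (\<Prod>B\<in>\<pi>. (-1) ^ card (B \<inter> S) * pochhammer x (card (B \<inter> S))))
        = a \<pi> * (\<Prod>B\<in>\<pi>. pochhammer x (card (B \<inter> S)))"
      by (simp add: prod.distrib flip: mult.assoc power_add)
  qed simp
  finally show ?thesis .
qed

section \<open>Collecting set partitions by type\<close>

lemma partition_type_in_ubc_types:
  assumes "d \<ge> 1" and "\<pi> \<in> set_partitions d"
  shows "partition_type d \<pi> \<in> ubc_types d"
proof -
  have \<pi>: "partition_on {1..d} \<pi>" using assms by (simp add: set_partitions_def)
  have fin: "finite \<pi>" using finite_elements[OF _ \<pi>] by simp
  have b: "block \<pi> d \<in> \<pi>" using block_mem[OF \<pi>] assms by simp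
  have pos: "card B > 0" if "B \<in> \<pi>" for B
  proof -
    have "B \<subseteq> {1..d}" "B \<noteq> {}" using that \<pi> by (auto simp: partition_on_def)
    then show ?thesis using finite_subset by (auto simp: card_gt_0_iff)
  qed
  have "(\<Sum>B\<in>\<pi>. card B) = d"
  proof -
    have "B \<inter> {1..d} = B" if "B \<in> \<pi>" for B using that \<pi> by (auto simp: partition_on_def)
    then show ?thesis using card_eq_sum_blocks[OF \<pi>, of "{1..d}"] by simp
  qed
  then have "(\<Sum>B\<in>\<pi> - {block \<pi> d}. card B) + card (block \<pi> d) = d"
    using sum.remove[OF fin b, of card] by simp
  moreover have "0 \<notin># image_mset card (mset_set (\<pi> - {block \<pi> d}))"
  proof
    assume "0 \<in># image_mset card (mset_set (\<pi> - {block \<pi> d}))"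
    then have "0 \<in> card ` (\<pi> - {block \<pi> d})" using fin by simp
    then obtain B where "B \<in> \<pi>" "0 = card B" by blast
    then show False using pos[of B] by simp
  qed
  ultimately show ?thesis
    using pos[OF b] by (simp add: ubc_types_def partition_type_def sum_unfold_sum_mset Suc_le_eq)
qed

lemma lookup_sum_single:
  "Poly_Mapping.lookup (\<Sum>x\<in>A. Poly_Mapping.single (f x) (a x)) t = (\<Sum>x\<in>A. if f x = t then a x else 0)"
  by (induction A rule: infinite_finite_induct) (auto simp: lookup_add lookup_single when_def)

text \<open>The coefficient of a single set partition may be negative even if the total over each
  type is not. Weights that depend only on the type allow passing to these totals.\<close>

lemma sum_by_type:
  fixes a \<Phi> :: "_ \<Rightarrow> rat"
  assumes "finite A"
  shows "(\<Sum>x\<in>A. a x * \<Phi> (f x))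
    = (\<Sum>t\<in>f ` A. Poly_Mapping.lookup (\<Sum>x\<in>A. Poly_Mapping.single (f x) (a x)) t * \<Phi> t)"
proof -
  have "(\<Sum>x\<in>A. a x * \<Phi> (f x)) = (\<Sum>t\<in>f ` A. \<Sum>x | x \<in> A \<and> f x = t. a x * \<Phi> (f x))"
    using assms by (rule sum.image_gen)
  also have "\<dots> = (\<Sum>t\<in>f ` A. Poly_Mapping.lookup (\<Sum>x\<in>A. Poly_Mapping.single (f x) (a x)) t * \<Phi> t)"
    using assms by (auto simp: lookup_sum_single sum_distrib_right sum.inter_filter intro!: sum.cong)
  finally show ?thesis .
qed

text \<open>Both weights depend only on the type: removing \<open>d\<close> shortens its own block
  from \<open>b\<close> to \<open>b - 1\<close> and leaves the other blocks alone.\<close>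

lemma prod_blocks_pochhammer:
  fixes x :: rat
  assumes "d \<ge> 1" and "\<pi> \<in> set_partitions d" and type: "partition_type d \<pi> = (l, b)"
  shows "(\<Prod>B\<in>\<pi>. pochhammer x (card (B \<inter> {1..d}))) = pochhammer x b * (\<Prod>k\<in>#l. pochhammer x k)"
    and "(\<Prod>B\<in>\<pi>. pochhammer x (card (B \<inter> ({1..d} - {d})))) = pochhammer x (b - 1) * (\<Prod>k\<in>#l. pochhammer x k)"
proof -
  let ?b = "block \<pi> d"
  have \<pi>: "partition_on {1..d} \<pi>" using assms by (simp add: set_partitions_def)
  have fin: "finite \<pi>" using finite_elements[OF _ \<pi>] by simp
  have b: "?b \<in> \<pi>" "d \<in> ?b" using block_mem[OF \<pi>] assms by simp_all
  have sub: "B \<subseteq> {1..d}" if "B \<in> \<pi>" for B using that \<pi> by (auto simp: partition_on_def)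
  have l: "(\<Prod>k\<in>#l. pochhammer x k) = (\<Prod>B\<in>\<pi> - {?b}. pochhammer x (card B))"
    and card_b: "card ?b = b"
    using type by (auto simp: partition_type_def prod_unfold_prod_mset image_mset.compositionality comp_def)
  have inter: "B \<inter> {1..d} = B" if "B \<in> \<pi>" for B using sub[OF that] by blast
  have inter': "B \<inter> ({1..d} - {d}) = B" if "B \<in> \<pi> - {?b}" for B
    using sub[of B] that block_eq[OF \<pi>, of B d] by auto
  have "(\<Prod>B\<in>\<pi>. pochhammer x (card (B \<inter> {1..d}))) = (\<Prod>B\<in>\<pi>. pochhammer x (card B))"
    using inter by simp
  also have "\<dots> = pochhammer x (card ?b) * (\<Prod>B\<in>\<pi> - {?b}. pochhammer x (card B))"
    using fin b(1) by (rule prod.remove)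
  finally show "(\<Prod>B\<in>\<pi>. pochhammer x (card (B \<inter> {1..d}))) = pochhammer x b * (\<Prod>k\<in>#l. pochhammer x k)"
    using l card_b by simp
  have "(\<Prod>B\<in>\<pi>. pochhammer x (card (B \<inter> ({1..d} - {d}))))
      = pochhammer x (card (?b \<inter> ({1..d} - {d}))) * (\<Prod>B\<in>\<pi> - {?b}. pochhammer x (card (B \<inter> ({1..d} - {d}))))"
    using fin b(1) by (rule prod.remove)
  also have "(\<Prod>B\<in>\<pi> - {?b}. pochhammer x (card (B \<inter> ({1..d} - {d})))) = (\<Prod>k\<in>#l. pochhammer x k)"
    unfolding l using inter' by (intro prod.cong) auto
  also have "?b \<inter> ({1..d} - {d}) = ?b - {d}" using sub[OF b(1)] by blast
  also have "card (?b - {d}) = b - 1" using b(2) card_b by simp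
  finally show "(\<Prod>B\<in>\<pi>. pochhammer x (card (B \<inter> ({1..d} - {d})))) = pochhammer x (b - 1) * (\<Prod>k\<in>#l. pochhammer x k)" .
qed

text \<open>Passing from \<open>b - 1\<close> to \<open>b\<close> multiplies the rising factorial by
  \<open>x + b - 1\<close>, which is at most \<open>b \<le> d\<close> because
  \<open>x \<le> 1\<close>.\<close>

lemma pochhammer_types_le:
  fixes x :: rat
  assumes "0 \<le> x" "x \<le> 1" and t: "(l, b) \<in> ubc_types d"
  shows "pochhammer x b * (\<Prod>k\<in>#l. pochhammer x k) \<le> of_nat d * (pochhammer x (b - 1) * (\<Prod>k\<in>#l. pochhammer x k))"
proof -
  have b: "1 \<le> b" "b \<le> d" using t by (auto simp: ubc_types_def)
  have nonneg: "0 \<le> pochhammer x n" for n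
    using assms(1) by (induction n) (simp_all add: pochhammer_Suc)
  have l: "0 \<le> (\<Prod>k\<in>#l. pochhammer x k)"
    by (induction l) (auto simp: nonneg)
  obtain n where n: "b = Suc n" using b by (cases b) auto
  have "x + of_nat n \<le> of_nat b" using assms(2) n by simp
  also have "\<dots> \<le> of_nat d" using b by simp
  finally have "x + of_nat n \<le> of_nat d" .
  then have "pochhammer x b \<le> of_nat d * pochhammer x (b - 1)"
    using n mult_left_mono[OF \<open>x + of_nat n \<le> of_nat d\<close> nonneg[of n]]
    by (simp add: pochhammer_Suc mult.commute)
  from mult_right_mono[OF this l] show ?thesis by (simp only: mult.assoc)
qed


section \<open>Relabelling and deletion of a vertex\<close>

text \<open>\<open>U\<close> contains the ends of all edges while \<open>V\<close> may omit
  vertices, which covers the graph and its vertex deletions alike. Injectivity on all of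
  \<open>U\<close> ensures that an image edge within the image of \<open>V\<close> comes from an
  edge within \<open>V\<close>.\<close>

lemma comps_inj_image:
  assumes inj: "inj_on \<phi> U" and E: "E \<subseteq> U \<times> U" and V: "V \<subseteq> U"
  shows "comps (\<phi> ` V) (map_prod \<phi> \<phi> ` E) = comps V E"
  unfolding comps_def
proof (rule card_quotient_eq[symmetric, where g = \<phi>])
  fix u w assume uw: "u \<in> V" "w \<in> V"
  have edge: "\<exists>a b. (a, b) \<in> E \<and> a \<in> V \<and> b \<in> V \<and> x = \<phi> a \<and> y = \<phi> b"
    if xy: "(x, y) \<in> map_prod \<phi> \<phi> ` E" "x \<in> \<phi> ` V" "y \<in> \<phi> ` V" for x y
  proof -
    obtain a b where ab: "(a, b) \<in> E" "x = \<phi> a" "y = \<phi> b" using xy(1) by auto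
    obtain a' b' where ab': "a' \<in> V" "b' \<in> V" "x = \<phi> a'" "y = \<phi> b'" using xy(2,3) by auto
    have "a \<in> U" "b \<in> U" "a' \<in> U" "b' \<in> U" using ab(1) ab' E V by auto
    then have "a = a'" "b = b'" using inj_onD[OF inj] ab ab' by metis+
    then show ?thesis using ab ab' by blast
  qed
  show "(\<phi> u, \<phi> w) \<in> conn (\<phi> ` V) (map_prod \<phi> \<phi> ` E) \<longleftrightarrow> (u, w) \<in> conn V E"
  proof
    assume A: "(\<phi> u, \<phi> w) \<in> conn (\<phi> ` V) (map_prod \<phi> \<phi> ` E)"
    have inv: "inv_into U \<phi> (\<phi> a) = a" if "a \<in> V" for a
      using inv_into_f_f[OF inj, of a] that V by blast
    show "(u, w) \<in> conn V E"
    proof (rule connI[OF uw])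
      fix f :: "'a \<Rightarrow> bool"
      assume f: "\<And>a b. (a, b) \<in> E \<Longrightarrow> a \<in> V \<Longrightarrow> b \<in> V \<Longrightarrow> f a = f b"
      have "(f \<circ> inv_into U \<phi>) (\<phi> u) = (f \<circ> inv_into U \<phi>) (\<phi> w)"
      proof (rule connD[OF A])
        fix x y assume "(x, y) \<in> map_prod \<phi> \<phi> ` E" "x \<in> \<phi> ` V" "y \<in> \<phi> ` V"
        then obtain a b where "(a, b) \<in> E" "a \<in> V" "b \<in> V" "x = \<phi> a" "y = \<phi> b"
          using edge by blast
        then show "(f \<circ> inv_into U \<phi>) x = (f \<circ> inv_into U \<phi>) y" using f inv by simp
      qed
      then show "f u = f w" using inv uw by simp
    qed
  next
    assume A: "(u, w) \<in> conn V E"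
    show "(\<phi> u, \<phi> w) \<in> conn (\<phi> ` V) (map_prod \<phi> \<phi> ` E)"
    proof (rule connI)
      fix f :: "'b \<Rightarrow> bool"
      assume f: "\<And>x y. (x, y) \<in> map_prod \<phi> \<phi> ` E \<Longrightarrow> x \<in> \<phi> ` V \<Longrightarrow> y \<in> \<phi> ` V \<Longrightarrow> f x = f y"
      have "(f \<circ> \<phi>) u = (f \<circ> \<phi>) w"
      proof (rule connD[OF A])
        fix a b assume "(a, b) \<in> E" "a \<in> V" "b \<in> V"
        then show "(f \<circ> \<phi>) a = (f \<circ> \<phi>) b" using f[of "\<phi> a" "\<phi> b"] by force
      qed
      then show "f (\<phi> u) = f (\<phi> w)" by simp
    qed (use uw in auto)
  qed
next
  fix x assume "x \<in> \<phi> ` V"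
  then obtain a where "a \<in> V" "x = \<phi> a" by blast
  then show "\<exists>a\<in>V. (\<phi> a, x) \<in> conn (\<phi> ` V) (map_prod \<phi> \<phi> ` E)"
    by (intro bexI[of _ a]) (auto intro: connI)
qed (auto simp: equiv_conn)

section \<open>Agreement with strongly connected components, and existence of labellings\<close>

lemma (in sym_digraph) conn_eq_reachable:
  "conn (verts G) (arcs_ends G) = {(u, w). u \<rightarrow>\<^sup>* w}"
proof (intro equalityI subrelI)
  fix u w assume uw: "(u, w) \<in> conn (verts G) (arcs_ends G)"
  \<comment> \<open>The labelling to test is reachability from \<open>u\<close>, which symmetry
    makes constant along arcs.\<close>
  have "(u \<rightarrow>\<^sup>* u) = (u \<rightarrow>\<^sup>* w)"
  proof (rule connD[OF uw])
    fix a b assume "a \<rightarrow> b"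
    then have "a \<rightarrow>\<^sup>* b" by (rule reachable_adjI)
    moreover from this have "b \<rightarrow>\<^sup>* a" by (rule symmetric_reachable')
    ultimately show "(u \<rightarrow>\<^sup>* a) = (u \<rightarrow>\<^sup>* b)" by (metis reachable_trans)
  qed
  moreover have "u \<in> verts G" using uw conn_subset by fast
  ultimately show "(u, w) \<in> {(u, w). u \<rightarrow>\<^sup>* w}" by simp
next
  fix u w assume "(u, w) \<in> {(u, w). u \<rightarrow>\<^sup>* w}"
  then have uw: "u \<rightarrow>\<^sup>* w" by simp
  show "(u, w) \<in> conn (verts G) (arcs_ends G)"
  proof (rule connI)
    show "u \<in> verts G" "w \<in> verts G" using reachable_in_verts[OF uw] by auto
    fix f :: "'a \<Rightarrow> bool"
    assume f: "\<And>a b. a \<rightarrow> b \<Longrightarrow> a \<in> verts G \<Longrightarrow> b \<in> verts G \<Longrightarrow> f a = f b"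
    show "f u = f w"
      using uw
    proof (induction rule: reachable_induct)
      case (step x y)
      then show ?case using f[of x y] reachable_in_verts[of u x] adj_in_verts[of x y] by simp
    qed simp
  qed
qed

lemma (in sym_digraph) comps_eq_card_sccs:
  "comps (verts G) (arcs_ends G) = card sccs"
proof -
  have "scc_of u = conn (verts G) (arcs_ends G) `` {u}" for u
    unfolding conn_eq_reachable scc_of_def using symmetric_reachable' by blast
  then have "sccs_verts = verts G // conn (verts G) (arcs_ends G)"
    unfolding sccs_verts_conv_scc_of quotient_def by auto
  then show ?thesis unfolding comps_def using card_sccs_verts by simp
qed

lemma comps_restrict: "comps V (E \<inter> V \<times> V) = comps V E"
  by (simp add: comps_def conn_def Int_assoc)

lemma (in sym_digraph) comps_del_vert:
  "comps (verts G - {v}) (arcs_ends G) = card (pre_digraph.sccs (del_vert v))"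
proof -
  have sub: "arcs_ends (del_vert v) = arcs_ends G \<inter> (verts G - {v}) \<times> (verts G - {v})"
    by (auto simp: arcs_ends_conv del_vert_simps)
  have "sym (arcs_ends G)" using sym_arcs by (simp add: symmetric_def)
  then have "symmetric (del_vert v)"
    unfolding symmetric_def sub by (auto simp: sym_def)
  then interpret H: sym_digraph "del_vert v"
    by (intro sym_digraph.intro wf_digraph_del_vert sym_digraph_axioms.intro)
  show ?thesis
    using H.comps_eq_card_sccs unfolding sub by (simp add: verts_del_vert comps_restrict)
qed

text \<open>Guarantees that the choice operator in \<open>chromatic_y_at\<close> returns an actual
  labelling.\<close>

lemma labelling_at_exists:
  assumes "finite (verts G)" "v \<in> verts G"
  shows "\<exists>\<phi>. labelling_at G v \<phi>"
proof -
  let ?d = "card (verts G)"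
  have d: "?d \<ge> 1" using assms by (auto simp: Suc_le_eq card_gt_0_iff)
  have "card (verts G - {v}) = card {1..<?d}" using assms by simp
  then obtain h where h: "bij_betw h (verts G - {v}) {1..<?d}"
    using finite_same_card_bij[of "verts G - {v}" "{1..<?d}"] assms(1) by auto
  let ?\<phi> = "h(v := ?d)"
  have "bij_betw ?\<phi> (verts G - {v}) {1..<?d}"
    using h by (rule bij_betw_cong[THEN iffD1, rotated]) auto
  then have "bij_betw ?\<phi> ((verts G - {v}) \<union> {v}) ({1..<?d} \<union> {?\<phi> v})"
    by (intro notIn_Un_bij_betw) auto
  moreover have "(verts G - {v}) \<union> {v} = verts G" using assms(2) by auto
  moreover have "{1..<?d} \<union> {?\<phi> v} = {1..?d}" using d by auto
  ultimately have "bij_betw ?\<phi> (verts G) {1..?d}" by simp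
  then show ?thesis unfolding labelling_at_def by (intro exI[of _ ?\<phi>]) simp
qed

lemma arcs_ends_relabel: "arcs_ends (relabel \<phi> G) = map_prod \<phi> \<phi> ` arcs_ends G"
  by (simp add: arcs_ends_conv relabel_def image_image)

lemma chromatic_Y_eq_kernel_series:
  assumes V: "verts G = {1..d}" and E: "arcs_ends G \<subseteq> {1..d} \<times> {1..d}"
  shows "chromatic_Y G = kernel_series d {} (arcs_ends G)"
proof -
  have "proper_colourings G = {\<kappa> \<in> {1..d} \<rightarrow>\<^sub>E {0<..}. \<forall>(i, j) \<in> arcs_ends G. \<kappa> i \<noteq> \<kappa> j}"
    unfolding proper_colourings_def V by auto
  then show ?thesis
    unfolding chromatic_Y_def V using nc_monomial_sum_eq_kernel_series[OF E] by simp
qed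

section \<open>Comparison of the two expansions near zero\<close>

theorem proposition7p1:
  fixes G :: "('a, 'b) pre_digraph" and v :: 'a
  assumes "graph G"
    and "cut_vertex G v"
  shows "\<not> e_positive_at G v"
proof
  assume pos: "e_positive_at G v"
  interpret graph G by (rule assms(1))
  have v: "v \<in> verts G" and more: "card (pre_digraph.sccs (del_vert v)) > card sccs"
    using assms(2) by (auto simp: cut_vertex_def)
  define d where "d = card (verts G)"
  \<comment> \<open>The same choice as in \<open>chromatic_y_at\<close>, so the coefficients below
    are literally those of \<open>e_positive_at\<close>.\<close>
  define \<phi> where "\<phi> = (SOME \<phi>. labelling_at G v \<phi>)"
  define E where "E = arcs_ends (relabel \<phi> G)"
  have d: "d \<ge> 1" using v by (auto simp: d_def Suc_le_eq card_gt_0_iff)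
  have "labelling_at G v \<phi>"
    unfolding \<phi>_def using labelling_at_exists[OF finite_verts v] by (rule someI_ex)
  then have bij: "bij_betw \<phi> (verts G) {1..d}" and \<phi>v: "\<phi> v = d"
    by (simp_all add: labelling_at_def d_def)
  have inj: "inj_on \<phi> (verts G)" and img: "\<phi> ` verts G = {1..d}"
    using bij by (simp_all add: bij_betw_def)
  have ends: "arcs_ends G \<subseteq> verts G \<times> verts G" by (auto simp: arcs_ends_conv)
  have E: "E \<subseteq> {1..d} \<times> {1..d}"
    unfolding E_def arcs_ends_relabel img[symmetric] using ends by auto
  have loop: "(i, i) \<notin> E" for i
  proof
    assume "(i, i) \<in> E"
    then obtain e where e: "e \<in> arcs G" "\<phi> (tail G e) = \<phi> (head G e)"
      unfolding E_def arcs_ends_relabel unfolding arcs_ends_conv by auto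
    then have "tail G e = head G e" using inj_onD[OF inj] by simp
    then show False using no_loops e(1) by simp
  qed
  define k where "k = comps {1..d} E"
  define k' where "k' = comps ({1..d} - {d}) E"
  have "k = card sccs"
    using comps_inj_image[OF inj ends subset_refl] comps_eq_card_sccs
    by (simp add: k_def E_def arcs_ends_relabel img)
  moreover have "\<phi> ` (verts G - {v}) = {1..d} - {d}"
    using inj_on_image_set_diff[OF inj, of "verts G" "{v}"] v img \<phi>v by simp
  then have "k' = card (pre_digraph.sccs (del_vert v))"
    using comps_inj_image[OF inj ends, of "verts G - {v}"] comps_del_vert[of v]
    by (simp add: k'_def E_def arcs_ends_relabel)
  ultimately have kk': "Suc k \<le> k'" using more by simp

  define a where "a = (\<lambda>\<pi>. nc.representation (nc_e d ` set_partitions d) (kernel_series d {} E) (nc_e d \<pi>))"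
  have a: "kernel_series d {} E = (\<Sum>\<pi>\<in>set_partitions d. nc_scale (a \<pi>) (nc_e d \<pi>))"
    using kernel_series_eq_sum_nc_e[OF E] by (simp add: a_def set_partitions_def)
  define y where "y = (\<Sum>\<pi>\<in>set_partitions d. Poly_Mapping.single (partition_type d \<pi>) (a \<pi>))"
  have verts: "verts (relabel \<phi> G) = {1..d}" by (simp add: relabel_def img)
  have "chromatic_y_at G v = y"
    using chromatic_Y_eq_kernel_series[OF verts E[unfolded E_def]]
    by (simp add: chromatic_y_at_def chromatic_y_def nu_def y_def a_def set_partitions_def E_def verts flip: \<phi>_def)
  then have y: "Poly_Mapping.lookup y t \<ge> 0" if "t \<in> ubc_types d" for t
    using pos that by (simp add: e_positive_at_def d_def)
  let ?T = "partition_type d ` set_partitions d"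
  \<comment> \<open>Positivity is assumed only at indices in \<open>ubc_types d\<close>; this makes
    it available at every type that occurs.\<close>
  have types: "?T \<subseteq> ubc_types d" using partition_type_in_ubc_types[OF d] by auto

  obtain p :: "rat poly" and C where p: "\<forall>q. poly p (of_nat q) = of_nat (card (cols {1..d} E q))"
    and pC: "\<forall>x. 0 \<le> x \<longrightarrow> x \<le> 1 \<longrightarrow> x ^ k \<le> (-1) ^ card {1..d} * poly p (- x) \<and>
      (-1) ^ card {1..d} * poly p (- x) \<le> C * x ^ k"
    using chromatic_polynomial_bounds[OF finite_atLeastAtMost loop, of 1 d] unfolding k_def by blast
  obtain p' :: "rat poly" and C' where p': "\<forall>q. poly p' (of_nat q) = of_nat (card (cols ({1..d} - {d}) E q))"
    and pC': "\<forall>x. 0 \<le> x \<longrightarrow> x \<le> 1 \<longrightarrow> x ^ k' \<le> (-1) ^ card ({1..d} - {d}) * poly p' (- x) \<and>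
      (-1) ^ card ({1..d} - {d}) * poly p' (- x) \<le> C' * x ^ k'"
    using chromatic_polynomial_bounds[OF finite_Diff[OF finite_atLeastAtMost] loop, of 1 d "{d}"]
    unfolding k'_def by blast

  have key: "(-1) ^ card {1..d} * poly p (- x) \<le> of_nat d * ((-1) ^ card ({1..d} - {d}) * poly p' (- x))"
    if x: "0 \<le> x" "x \<le> 1" for x
  proof -
    let ?M = "\<lambda>l. \<Prod>k\<in>#l. pochhammer x k"
    let ?\<Phi> = "\<lambda>(l, b). pochhammer x b * ?M l" and ?\<Phi>' = "\<lambda>(l, b). pochhammer x (b - 1) * ?M l"
    have "(-1) ^ card {1..d} * poly p (- x) = (\<Sum>\<pi>\<in>set_partitions d. a \<pi> * ?\<Phi> (partition_type d \<pi>))"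
      unfolding reciprocal_chromatic_expansion[OF subset_refl E loop spec[OF p] a]
      using prod_blocks_pochhammer(1)[OF d] by (intro sum.cong) (auto split: prod.split)
    also have "\<dots> = (\<Sum>t\<in>?T. Poly_Mapping.lookup y t * ?\<Phi> t)"
      unfolding y_def by (rule sum_by_type[OF finite_set_partitions])
    \<comment> \<open>Here positivity enters: with nonnegative totals the inequality between the
      weights can be applied type by type.\<close>
    also have "\<dots> \<le> (\<Sum>t\<in>?T. Poly_Mapping.lookup y t * (of_nat d * ?\<Phi>' t))"
    proof (rule sum_mono, rule mult_left_mono)
      fix t assume "t \<in> ?T"
      then have t: "t \<in> ubc_types d" using types by blast
      then show "Poly_Mapping.lookup y t \<ge> 0" by (rule y)
      show "?\<Phi> t \<le> of_nat d * ?\<Phi>' t"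
        using pochhammer_types_le[OF x, of "fst t" "snd t" d] t by (simp add: case_prod_beta)
    qed
    also have "\<dots> = of_nat d * (\<Sum>t\<in>?T. Poly_Mapping.lookup y t * ?\<Phi>' t)"
      by (simp only: sum_distrib_left mult.left_commute)
    also have "(\<Sum>t\<in>?T. Poly_Mapping.lookup y t * ?\<Phi>' t) = (\<Sum>\<pi>\<in>set_partitions d. a \<pi> * ?\<Phi>' (partition_type d \<pi>))"
      unfolding y_def by (rule sum_by_type[OF finite_set_partitions, symmetric])
    also have "\<dots> = (-1) ^ card ({1..d} - {d}) * poly p' (- x)"
      unfolding reciprocal_chromatic_expansion[OF Diff_subset E loop spec[OF p'] a]
      using prod_blocks_pochhammer(2)[OF d] by (intro sum.cong) (auto split: prod.split)
    finally show ?thesis .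
  qed

  define D where "D = of_nat d * C'"
  have "(1 :: rat) \<le> C'" using spec[OF pC', of 1] by simp
  then have D: "D \<ge> 0" by (simp add: D_def)
  \<comment> \<open>The additional component after deletion supplies the spare factor
    \<open>x\<close> on the right.\<close>
  have bound: "x ^ k \<le> D * (x * x ^ k)" if x: "0 \<le> x" "x \<le> 1" for x
  proof -
    have "x ^ k \<le> (-1) ^ card {1..d} * poly p (- x)" using spec[OF pC, of x] x by blast
    also have "\<dots> \<le> of_nat d * ((-1) ^ card ({1..d} - {d}) * poly p' (- x))" using x by (rule key)
    also have "\<dots> \<le> of_nat d * (C' * x ^ k')"
      using spec[OF pC', of x] x by (intro mult_left_mono) auto
    also have "\<dots> = D * x ^ k'" by (simp add: D_def)
    also have "\<dots> \<le> D * x ^ Suc k"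
      using D power_decreasing[OF kk' x] by (intro mult_left_mono)
    finally show ?thesis by simp
  qed
  \<comment> \<open>Small enough that \<open>D * x < 1\<close>, which contradicts
    \<open>bound\<close> after cancelling the positive \<open>x ^ k\<close>; the summand 1 covers
    \<open>D = 0\<close>.\<close>
  define x where "x = 1 / (D + 1)"
  have x: "0 < x" "x \<le> 1" "D * x < 1" using D by (auto simp: x_def field_simps)
  have "x ^ k > 0" using x(1) by simp
  have "1 * x ^ k \<le> D * x * x ^ k" using bound[of x] x by (simp add: mult.assoc)
  then have "1 \<le> D * x" using \<open>x ^ k > 0\<close> by (rule mult_right_le_imp_le)
  then show False using x(3) by simp
qed

end
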